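(* Let $(W,S)_B$ be a Lorentzian Coxeter system with root system $\Phi$, set of limit roots $E(\Phi)$, and set of space-like weights $\Omega_r$. Then $E(\Phi)$ equals the residual set of the Boyd--Maxwell ball cluster $\{\mathrm{Ball}(\omega) : \omega\in\Omega_r\}$ generated by $(W,S)_B$, i.e. $$E(\Phi)=\widehat{Q}\setminus\bigcup_{\omega\in\Omega_r}\mathrm{int}\,\mathrm{Ball}(\omega).$$
   Context: **Geometric Coxeter system.** $(W,S)$ is a Coxeter system with $S$ finite, $|S|=n$, with relations $(st)^{m_{st}}=e$ ($m_{ss}=1$, $m_{st}=m_{ts}\in\{2,3,\dots\}\cup\{\infty\}$ for $s\neq t$). $B$ is a symmetric matrix with $B_{st}=-\cos(\pi/m_{st})$ if $m_{st}<\infty$ and $B_{st}=-c_{st}$ if $m_{st}=\infty$, where the reals $c_{st}=c_{ts}\ge 1$ are chosen arbitrarily. $V$ is a real vector space with basis $\Delta=\{\alpha_s\}_{s\in S}$ (simple roots), with symmetric bilinear form $\mathcal B(\alpha_s,\alpha_t)=B_{st}$. $W$ acts faithfully on $V$, preserving $\mathcal B$, by $s\mapsto\sigma_{\alpha_s}$, where $\sigma_\alpha(x)=x-2\frac{\mathcal B(x,\alpha)}{\mathcal B(\alpha,\alpha)}\alpha$. The system is *Lorentzian* if $B$ has signature $(n-1,1)$. **Roots and weights.** The set of roots is $\Phi=W(\Delta)$. The fundamental weights $\Delta^*=\{\omega_s\}_{s\in S}\subset V$ are defined by $\mathcal B(\alpha_s,\omega_t)=\delta_{st}$, and the set of weights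 is $\Omega=W(\Delta^* )$. A vector $x$ is space-like if $\mathcal B(x,x)>0$ and light-like if $\mathcal B(x,x)=0$. $\Omega_r\subset\Omega$ is the set of space-like weights. **Projective notation.** For $x\in V\setminus\{0\}$, $\widehat x\in\mathbb PV$ is the line spanned by $x$. $Q=\{x\in V:\mathcal B(x,x)=0\}$, and $\widehat Q\subset\mathbb PV$ is its projectivization (topologically an $(n-2)$-sphere). $E(\Phi)$ is the set of limit roots: all $\widehat x\in\mathbb PV$ such that there is an injective sequence $(\gamma_i)$ in $\Phi$ with $\widehat\gamma_i\to\widehat x$. **Future direction.** Let $h$ be the sum of coordinates in the basis $\Delta$; if the hyperplane $h=0$ meets $Q$ outside the origin, replace $h$ by a linear form with positive coefficients in the coordinates with respect to $\Delta$ whose kernel meets $Q$ only at $0$. Let $Q^+=\{x\in Q: h(x)>0\}$; each point of $\widehat Q$ has a representative in $Q^+$, unique up to positive scaling. **Balls.** For a space-like vector $x$, $\mathrm{Ball}(x)=\{\widehat{y}: y\in Q^+,\ \mathcal B(x,y)\le 0\}$, a closed ball (spherical cap) in $\widehat Q$. Its interior is $\mathrm{int}\,\mathrm{Ball}(x)=\{\widehat{y}: y\in Q^+,\ \mathcal B(x,y)<0\}$. The Boyd--Maxwell ball cluster generated by $(W,S)_B$ is $\{\mathrm{Ball}(\omega):\omega\in\Omega_r\}$ (possibly empty). The residual set of a collection of balls is the complement in $\widehat Q$ of the union of the interiors of all its balls. *)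

theory Defs
  imports
    "HOL-Analysis.Analysis"
    "HOL-Algebra.Generated_Groups"
    "HOL-Algebra.Group_Action"
    "HOL-Library.Extended_Nat"
begin

section \<open>Coxeter systems\<close>

text \<open>The finite set \<open>S\<close> is the range of a map \<open>g\<close> from a finite index type \<open>'s\<close> into the group,
  so that \<open>n = CARD('s)\<close>.\<close>

definition coxeter_matrix :: "('s \<Rightarrow> 's \<Rightarrow> enat) \<Rightarrow> bool" where
  "coxeter_matrix m \<longleftrightarrow>
     (\<forall>s. m s s = 1) \<and> (\<forall>s t. s \<noteq> t \<longrightarrow> m s t = m t s \<and> m s t \<ge> 2)"

text \<open>The congruence on words generated by \<open>(s t)^m(s,t) = e\<close>.  As \<open>m s s = 1\<close>, every letter is its own
  inverse, so this monoid presentation presents the Coxeter group; formal inverses are not needed.\<close>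

inductive coxeter_cong :: "('s \<Rightarrow> 's \<Rightarrow> enat) \<Rightarrow> 's list \<Rightarrow> 's list \<Rightarrow> bool"
  for m :: "'s \<Rightarrow> 's \<Rightarrow> enat" where
  relation: "m s t = enat k \<Longrightarrow> coxeter_cong m (concat (replicate k [s, t])) []"
| refl: "coxeter_cong m xs xs"
| sym: "coxeter_cong m xs ys \<Longrightarrow> coxeter_cong m ys xs"
| trans: "coxeter_cong m xs ys \<Longrightarrow> coxeter_cong m ys zs \<Longrightarrow> coxeter_cong m xs zs"
| congr: "coxeter_cong m xs ys \<Longrightarrow> coxeter_cong m (us @ xs @ vs) (us @ ys @ vs)"

definition word_value :: "('w, 'b) monoid_scheme \<Rightarrow> ('s \<Rightarrow> 'w) \<Rightarrow> 's list \<Rightarrow> 'w" where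
  "word_value W g xs = foldr (\<lambda>s w. g s \<otimes>\<^bsub>W\<^esub> w) xs \<one>\<^bsub>W\<^esub>"

definition coxeter_system ::
    "('w, 'b) monoid_scheme \<Rightarrow> ('s::finite \<Rightarrow> 'w) \<Rightarrow> ('s \<Rightarrow> 's \<Rightarrow> enat) \<Rightarrow> bool" where
  "coxeter_system W g m \<longleftrightarrow>
     group W \<and> coxeter_matrix m \<and>
     range g \<subseteq> carrier W \<and> generate W (range g) = carrier W \<and>
     (\<forall>xs ys. word_value W g xs = word_value W g ys \<longleftrightarrow> coxeter_cong m xs ys)"


section \<open>The geometric representation\<close>

text \<open>\<open>V\<close> is \<open>real ^ 's\<close>; its standard basis plays the role of the simple roots \<open>\<Delta>\<close>.\<close>

definition simple_root :: "'s::finite \<Rightarrow> real ^ 's" where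
  "simple_root s = axis s 1"

definition gram_matrix :: "('s::finite \<Rightarrow> 's \<Rightarrow> enat) \<Rightarrow> ('s \<Rightarrow> 's \<Rightarrow> real) \<Rightarrow> real ^ 's ^ 's" where
  "gram_matrix m c =
     (\<chi> s t. case m s t of enat k \<Rightarrow> - cos (pi / real k) | \<infinity> \<Rightarrow> - c s t)"

text \<open>The values of \<open>c\<close> at pairs with \<open>m s t < \<infinity>\<close> are irrelevant.\<close>

definition admissible_parameters :: "('s \<Rightarrow> 's \<Rightarrow> enat) \<Rightarrow> ('s \<Rightarrow> 's \<Rightarrow> real) \<Rightarrow> bool" where
  "admissible_parameters m c \<longleftrightarrow> (\<forall>s t. m s t = \<infinity> \<longrightarrow> c s t = c t s \<and> c s t \<ge> 1)"

definition form :: "real ^ 's ^ 's \<Rightarrow> real ^ 's \<Rightarrow> real ^ 's \<Rightarrow> real" where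
  "form B x y = x \<bullet> (B *v y)"

definition reflection :: "real ^ 's ^ 's \<Rightarrow> real ^ 's \<Rightarrow> real ^ 's \<Rightarrow> real ^ 's" where
  "reflection B a x = x - (2 * (form B x a / form B a a)) *\<^sub>R a"

text \<open>Since \<open>range g\<close> generates \<open>W\<close>, this determines \<open>\<rho>\<close> on the carrier; the action is by linear maps
  preserving the form because the simple reflections are such maps.\<close>

definition geometric_action ::
    "('w, 'b) monoid_scheme \<Rightarrow> ('s::finite \<Rightarrow> 'w) \<Rightarrow> real ^ 's ^ 's
      \<Rightarrow> ('w \<Rightarrow> real ^ 's \<Rightarrow> real ^ 's) \<Rightarrow> bool" where
  "geometric_action W g B \<rho> \<longleftrightarrow>
     group_action W UNIV \<rho> \<and> (\<forall>s. \<rho> (g s) = reflection B (simple_root s))"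

text \<open>Signature through diagonalisation by congruence: the columns of \<open>P\<close> form an orthogonal basis
  for the form with \<open>p\<close> vectors of positive and \<open>q\<close> vectors of negative square.  By Sylvester's law
  of inertia \<open>(p, q)\<close> does not depend on \<open>P\<close>.\<close>

definition has_signature :: "real ^ 's ^ 's \<Rightarrow> nat \<Rightarrow> nat \<Rightarrow> bool" where
  "has_signature B p q \<longleftrightarrow>
     (\<exists>P :: real ^ 's ^ 's. invertible P \<and>
        (let D = transpose P ** B ** P in
           (\<forall>i j. i \<noteq> j \<longrightarrow> D $ i $ j = 0) \<and>
           card {i. D $ i $ i > 0} = p \<and> card {i. D $ i $ i < 0} = q))"

definition lorentzian :: "real ^ 's ^ 's \<Rightarrow> bool" where
  "lorentzian B \<longleftrightarrow> has_signature B (CARD('s) - 1) 1"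


section \<open>Roots and weights\<close>

definition roots ::
    "('w, 'b) monoid_scheme \<Rightarrow> ('w \<Rightarrow> real ^ 's \<Rightarrow> real ^ 's) \<Rightarrow> (real ^ 's::finite) set" where
  "roots W \<rho> = (\<Union>s. orbit W \<rho> (simple_root s))"

text \<open>The description is proper as soon as \<open>B\<close> is nonsingular, in particular for Lorentzian \<open>B\<close>.\<close>

definition fundamental_weight :: "real ^ 's ^ 's \<Rightarrow> 's::finite \<Rightarrow> real ^ 's" where
  "fundamental_weight B t = (THE w. \<forall>s. form B (simple_root s) w = (if s = t then 1 else 0))"

definition weights ::
    "('w, 'b) monoid_scheme \<Rightarrow> ('w \<Rightarrow> real ^ 's \<Rightarrow> real ^ 's) \<Rightarrow> real ^ 's ^ 's
      \<Rightarrow> (real ^ 's::finite) set" where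
  "weights W \<rho> B = (\<Union>s. orbit W \<rho> (fundamental_weight B s))"

definition spacelike_weights ::
    "('w, 'b) monoid_scheme \<Rightarrow> ('w \<Rightarrow> real ^ 's \<Rightarrow> real ^ 's) \<Rightarrow> real ^ 's ^ 's
      \<Rightarrow> (real ^ 's::finite) set" where
  "spacelike_weights W \<rho> B = {x \<in> weights W \<rho> B. form B x x > 0}"


section \<open>Projective space and limit roots\<close>

text \<open>A point of the projective space is a line, i.e. the set \<open>span {x}\<close> with \<open>x \<noteq> 0\<close>.\<close>

definition proj_space :: "'v::real_normed_vector set set" where
  "proj_space = (\<lambda>x. span {x}) ` (UNIV - {0})"

definition proj_topology :: "'v::real_normed_vector set topology" where
  "proj_topology = topology (\<lambda>U. U \<subseteq> proj_space \<and> open {x. x \<noteq> 0 \<and> span {x} \<in> U})"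

lemma openin_proj_topology:
  "openin proj_topology U \<longleftrightarrow>
     U \<subseteq> (proj_space :: 'v::real_normed_vector set set) \<and> open {x. x \<noteq> 0 \<and> span {x} \<in> U}"
proof -
  have "istopology (\<lambda>U. U \<subseteq> (proj_space :: 'v set set) \<and> open {x. x \<noteq> 0 \<and> span {x} \<in> U})"
    unfolding istopology_def
  proof (intro conjI allI impI)
    fix U V :: "'v set set"
    assume U: "U \<subseteq> proj_space \<and> open {x. x \<noteq> 0 \<and> span {x} \<in> U}"
      and V: "V \<subseteq> proj_space \<and> open {x. x \<noteq> 0 \<and> span {x} \<in> V}"
    show "U \<inter> V \<subseteq> proj_space" using U by blast
    have "{x. x \<noteq> 0 \<and> span {x} \<in> U \<inter> V} =
      {x. x \<noteq> 0 \<and> span {x} \<in> U} \<inter> {x. x \<noteq> 0 \<and> span {x} \<in> V}" by blast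
    then show "open {x. x \<noteq> 0 \<and> span {x} \<in> U \<inter> V}" using U V by (simp only: open_Int)
  next
    fix K :: "'v set set set"
    assume K: "\<forall>U\<in>K. U \<subseteq> proj_space \<and> open {x. x \<noteq> 0 \<and> span {x} \<in> U}"
    then show "\<Union>K \<subseteq> proj_space" by blast
    have "{x. x \<noteq> 0 \<and> span {x} \<in> \<Union>K} = (\<Union>U\<in>K. {x. x \<noteq> 0 \<and> span {x} \<in> U})" by blast
    then show "open {x. x \<noteq> 0 \<and> span {x} \<in> \<Union>K}" using K by (simp only:) blast
  qed
  then show ?thesis by (simp add: proj_topology_def topology_inverse')
qed

lemma topspace_proj_topology: "topspace proj_topology = (proj_space :: 'v::real_normed_vector set set)"
proof -
  have "{x :: 'v. x \<noteq> 0 \<and> span {x} \<in> proj_space} = - {0}"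
    by (auto simp: proj_space_def)
  then have "openin proj_topology (proj_space :: 'v set set)"
    by (simp add: openin_proj_topology open_Compl)
  then show ?thesis
    by (metis openin_proj_topology openin_subset openin_topspace subset_antisym)
qed

lemma quotient_map_proj_topology:
  "quotient_map (top_of_set (UNIV - {0})) proj_topology (\<lambda>x :: 'v::real_normed_vector. span {x})"
proof -
  have "open (UNIV - {0 :: 'v})" by (simp add: open_delete)
  moreover have "{x \<in> UNIV - {0}. span {x} \<in> U} = {x. x \<noteq> 0 \<and> span {x} \<in> U}" for U :: "'v set set"
    by blast
  ultimately show ?thesis
    unfolding quotient_map_def topspace_proj_topology
    by (auto simp: proj_space_def[symmetric] openin_proj_topology openin_open_eq)
qed

definition limit_roots :: "'v::real_normed_vector set \<Rightarrow> 'v set set" where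
  "limit_roots \<Phi> = {p \<in> proj_space. \<exists>\<gamma> :: nat \<Rightarrow> 'v. inj \<gamma> \<and> range \<gamma> \<subseteq> \<Phi> \<and>
     limitin proj_topology (\<lambda>i. span {\<gamma> i}) p sequentially}"


section \<open>The light cone and balls\<close>

definition light_cone :: "real ^ 's ^ 's \<Rightarrow> (real ^ 's) set" where
  "light_cone B = {x. form B x x = 0}"

definition proj_light_cone :: "real ^ 's ^ 's \<Rightarrow> (real ^ 's) set set" where
  "proj_light_cone B = (\<lambda>x. span {x}) ` (light_cone B - {0})"

definition meets_light_cone_trivially :: "real ^ 's ^ 's \<Rightarrow> (real ^ 's \<Rightarrow> real) \<Rightarrow> bool" where
  "meets_light_cone_trivially B h \<longleftrightarrow> {x \<in> light_cone B. h x = 0} = {0}"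

text \<open>The linear form selecting the future direction is the sum of coordinates whenever its kernel
  meets the light cone only in \<open>0\<close>; otherwise it is an arbitrary form with positive coefficients
  that has this property.\<close>

definition future_form :: "real ^ 's ^ 's \<Rightarrow> (real ^ 's \<Rightarrow> real) \<Rightarrow> bool" where
  "future_form B h \<longleftrightarrow>
     (if meets_light_cone_trivially B (\<lambda>x. \<Sum>s\<in>UNIV. x $ s)
      then h = (\<lambda>x. \<Sum>s\<in>UNIV. x $ s)
      else (\<exists>a. (\<forall>s. a s > 0) \<and> h = (\<lambda>x. \<Sum>s\<in>UNIV. a s * x $ s)) \<and>
           meets_light_cone_trivially B h)"

definition future_light_cone :: "real ^ 's ^ 's \<Rightarrow> (real ^ 's \<Rightarrow> real) \<Rightarrow> (real ^ 's) set" where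
  "future_light_cone B h = {x \<in> light_cone B. h x > 0}"

text \<open>The interior of \<open>Ball(x)\<close>, which itself is given by the weak inequality \<open>form B x y \<le> 0\<close>.\<close>

definition ball_interior ::
    "real ^ 's ^ 's \<Rightarrow> (real ^ 's \<Rightarrow> real) \<Rightarrow> real ^ 's \<Rightarrow> (real ^ 's) set set" where
  "ball_interior B h x = {span {y} | y. y \<in> future_light_cone B h \<and> form B x y < 0}"

end

theory Submission
  imports Defs
begin

text \<open>Roots are nonnegative or nonpositive combinations of the simple roots, form a discrete set, and
  future light-like vectors pair nonpositively. Hence a limit root is isotropic and its whole orbit
  stays in the nonnegative cone, i.e. pairs nonnegatively with every weight.

  Conversely, if a future light-like \<open>y\<close> is not a limit root, then by compactness only finitely many
  positive roots \<open>\<gamma>\<close> satisfy \<open>form B y \<gamma> \<ge> 0\<close>, so finitely many simple reflections move \<open>y\<close> to a vector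
  \<open>x\<close> with \<open>form B x \<alpha> \<le> 0\<close> for all simple roots \<open>\<alpha>\<close>. If \<open>y\<close> is in no open ball, then \<open>x\<close> has nonnegative
  coordinates (weights that are not space-like are past vectors and impose no condition), so \<open>x\<close>
  is orthogonal to every simple root in its support. The sum of the finitely many positive
  roots orthogonal to \<open>x\<close> pairs to \<open>1\<close> with these simple roots, hence positively with \<open>x\<close>, although
  each summand is orthogonal to \<open>x\<close>.\<close>

section \<open>The bilinear form\<close>

lemma form_add_left: "form B (x + y) z = form B x z + form B y z"
  by (simp add: form_def inner_add_left)

lemma form_add_right: "form B x (y + z) = form B x y + form B x z"
  by (simp add: form_def matrix_vector_right_distrib inner_add_right)

lemma form_scaleR_left: "form B (a *\<^sub>R x) y = a * form B x y"
  by (simp add: form_def)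

lemma form_scaleR_right: "form B x (a *\<^sub>R y) = a * form B x y"
  by (simp add: form_def matrix_vector_mult_scaleR)

lemma form_minus_left: "form B (- x) y = - form B x y"
  by (simp add: form_def)

lemma form_minus_right: "form B x (- y) = - form B x y"
  using form_scaleR_right[of B x "-1" y] by simp

lemma form_diff_left: "form B (x - y) z = form B x z - form B y z"
  by (simp add: form_def inner_diff_left)

lemma form_diff_right: "form B x (y - z) = form B x y - form B x z"
  by (simp add: form_def matrix_vector_mult_diff_distrib inner_diff_right)

lemma form_zero_left [simp]: "form B 0 x = 0"
  by (simp add: form_def)

lemma form_zero_right [simp]: "form B x 0 = 0"
  by (simp add: form_def)

lemma form_sum_right: "form B x (sum f A) = (\<Sum>i\<in>A. form B x (f i))"
  by (induction A rule: infinite_finite_induct) (auto simp: form_add_right)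

lemmas form_linear = form_add_left form_add_right form_scaleR_left form_scaleR_right
  form_minus_left form_minus_right form_diff_left form_diff_right

lemma form_simple_root_left: "form B (simple_root s) y = (\<Sum>t\<in>UNIV. B $ s $ t * y $ t)"
  by (simp add: form_def simple_root_def inner_axis' matrix_vector_mult_def)

lemma form_simple_roots [simp]: "form B (simple_root s) (simple_root t) = B $ s $ t"
  by (simp add: form_simple_root_left) (simp add: simple_root_def axis_def if_distrib cong: if_cong)

lemma form_expand_left: "form B x y = (\<Sum>s\<in>UNIV. x $ s * form B (simple_root s) y)"
proof -
  have "form B (simple_root s) y = (B *v y) $ s" for s
    by (simp add: form_def simple_root_def inner_axis')
  then show ?thesis by (simp add: form_def inner_vec_def)
qed

lemma continuous_on_form [continuous_intros]:
  assumes "continuous_on S f" "continuous_on S g"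
  shows "continuous_on S (\<lambda>x. form B (f x) (g x))"
  unfolding form_def
  by (intro continuous_intros assms
      bounded_linear.continuous_on[OF matrix_vector_mul_bounded_linear])

lemma tendsto_form [tendsto_intros]:
  assumes "(f \<longlongrightarrow> x) F" "(g \<longlongrightarrow> y) F"
  shows "((\<lambda>i. form B (f i) (g i)) \<longlongrightarrow> form B x y) F"
  unfolding form_def
  by (intro tendsto_intros assms bounded_linear.tendsto[OF _ assms(2), of "\<lambda>y. B *v y"])
    (simp add: matrix_vector_mul_bounded_linear)

lemma simple_root_nth: "simple_root s $ t = (if t = s then 1 else 0)"
  by (simp add: simple_root_def axis_def)

lemma simple_root_nonneg: "0 \<le> (simple_root s :: real ^ 's::finite)"
  by (simp add: less_eq_vec_def simple_root_nth)

lemma vec_nonneg_iff: "0 \<le> (x :: real ^ 's::finite) \<longleftrightarrow> (\<forall>s. 0 \<le> x $ s)"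
  by (simp add: less_eq_vec_def)

lemma vec_eq_simple_root_multiple:
  "x = x $ s *\<^sub>R simple_root s" if "\<And>t. t \<noteq> s \<Longrightarrow> x $ t = 0"
  using that by (simp add: vec_eq_iff simple_root_nth)

lemma simple_root_expansion: "x = (\<Sum>s\<in>UNIV. x $ s *\<^sub>R simple_root s)"
  by (simp add: vec_eq_iff simple_root_nth if_distrib cong: if_cong)


section \<open>Simple reflections\<close>

text \<open>The word grows at its left end: it always ends in \<open>t\<close>, and the parity of
  the length decides its first letter. As \<open>foldr\<close> applies the last letter first, the
  reflection of \<open>t\<close> acts first.\<close>

primrec alternating :: "'a \<Rightarrow> 'a \<Rightarrow> nat \<Rightarrow> 'a list" where
  "alternating s t 0 = []"
| "alternating s t (Suc k) = (if even k then t else s) # alternating s t k"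

lemma length_alternating [simp]: "length (alternating s t k) = k"
  by (induction k) auto

lemma alternating_Suc_snoc: "alternating s t (Suc k) = alternating t s k @ [t]"
  by (induction k) auto

lemma alternating_suffix:
  "j \<le> k \<Longrightarrow> \<exists>xs. length xs = k - j \<and> alternating s t k = xs @ alternating s t j"
proof (induction k)
  case (Suc k)
  show ?case
  proof (cases "j = Suc k")
    case False
    with Suc obtain xs where "length xs = k - j" "alternating s t k = xs @ alternating s t j"
      by force
    with False Suc.prems show ?thesis
      by (intro exI[of _ "(if even k then t else s) # xs"]) auto
  qed auto
qed auto

lemma foldr_alternating:
  "foldr f (alternating s t (2 * k)) x = ((f s \<circ> f t) ^^ k) x"
  by (induction k) auto

text \<open>The Chebyshev polynomial of the second kind of degree n - 1, with value 0 at n = 0. Its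
  values turn out to be the coordinates of roots in a rank-two subsystem.\<close>

fun chebyshev_U :: "real \<Rightarrow> nat \<Rightarrow> real" where
  "chebyshev_U c 0 = 0"
| "chebyshev_U c (Suc 0) = 1"
| "chebyshev_U c (Suc (Suc n)) = 2 * c * chebyshev_U c (Suc n) - chebyshev_U c n"

lemma sin_times_chebyshev_U: "sin \<theta> * chebyshev_U (cos \<theta>) n = sin (real n * \<theta>)"
proof (induction "cos \<theta>" n rule: chebyshev_U.induct)
  case (3 n)
  have "sin (real (Suc (Suc n)) * \<theta>) + sin (real n * \<theta>) = 2 * cos \<theta> * sin (real (Suc n) * \<theta>)"
    using sin_plus_sin[of "real (Suc (Suc n)) * \<theta>" "real n * \<theta>"]
    by (simp add: algebra_simps add_divide_distrib)
  with 3 show ?case by (simp add: algebra_simps)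
qed auto

text \<open>A quotient of two sines: for \<open>n \<le> k\<close> the angle n * pi / k does not
  exceed pi. Beyond that range the sign would change, so alternating words must be kept
  short.\<close>

lemma chebyshev_U_cos_nonneg:
  assumes "2 \<le> k" "n \<le> k"
  shows "0 \<le> chebyshev_U (cos (pi / real k)) n"
proof -
  have "pi / real k < pi" using assms by (simp add: divide_less_eq)
  then have pos: "0 < sin (pi / real k)"
    using assms by (intro sin_gt_zero) auto
  have "real n * (pi / real k) \<le> pi"
    using assms by (simp add: field_simps)
  then have "0 \<le> sin (real n * (pi / real k))"
    by (intro sin_ge_zero) auto
  then show ?thesis
    using pos sin_times_chebyshev_U[of "pi / real k" n] by (metis zero_le_mult_iff not_le)
qed

lemma chebyshev_U_nonneg:
  assumes "1 \<le> c"
  shows "0 \<le> chebyshev_U c n"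
proof -
  \<comment> \<open>Nonnegativity is not inductive by itself, because the recursion subtracts a
    term; monotonicity is carried along to control it.\<close>
  have "0 \<le> chebyshev_U c n \<and> chebyshev_U c n \<le> chebyshev_U c (Suc n)"
  proof (induction n)
    case (Suc n)
    have "chebyshev_U c (Suc n) \<le> c * chebyshev_U c (Suc n)"
      using mult_right_mono[OF assms, of "chebyshev_U c (Suc n)"] Suc by simp
    with Suc show ?case by simp
  qed simp
  then show ?thesis ..
qed

text \<open>Group elements are represented by words acting through \<open>foldr\<close>. The
  assumption \<open>dihedral\<close> ties each off-diagonal entry above -1 to a relation: an angle
  pi / k comes with the k-th power of the product of the two reflections being the identity.\<close>

locale reflection_representation =
  fixes B :: "real ^ 's::finite ^ 's"
  assumes B_sym: "B $ s $ t = B $ t $ s"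
    and B_diag: "B $ s $ s = 1"
    and dihedral: "s \<noteq> t \<Longrightarrow> B $ s $ t \<le> - 1 \<or> (\<exists>k\<ge>2. B $ s $ t = - cos (pi / real k) \<and>
      (reflection B (simple_root s) \<circ> reflection B (simple_root t)) ^^ k = id)"
begin

abbreviation sigma :: "'s \<Rightarrow> real ^ 's \<Rightarrow> real ^ 's" where
  "sigma s \<equiv> reflection B (simple_root s)"

abbreviation act :: "'s list \<Rightarrow> real ^ 's \<Rightarrow> real ^ 's" where
  "act \<equiv> foldr sigma"

lemma B_offdiag: "s \<noteq> t \<Longrightarrow> B $ s $ t \<le> 0"
proof -
  assume "s \<noteq> t"
  moreover have "0 \<le> cos (pi / real k)" if "2 \<le> k" for k
    using that by (intro cos_ge_zero) (auto simp: field_simps intro: order_trans[of _ 0])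
  ultimately show ?thesis using dihedral[of s t] by force
qed

lemma form_commute: "form B x y = form B y x"
proof -
  have "transpose B = B" by (simp add: transpose_def vec_eq_iff B_sym)
  then have "(B *v y) \<bullet> x = form B y x"
    by (metis dot_lmul_matrix transpose_matrix_vector form_def)
  then show ?thesis by (simp add: form_def inner_commute)
qed

lemma form_expand_right: "form B x y = (\<Sum>s\<in>UNIV. y $ s * form B x (simple_root s))"
  using form_expand_left[of B y x] by (simp add: form_commute[of x])

lemma sigma_eq: "sigma s x = x - (2 * form B x (simple_root s)) *\<^sub>R simple_root s"
  by (simp add: reflection_def B_diag)

lemma sigma_nth: "t \<noteq> s \<Longrightarrow> sigma s x $ t = x $ t"
  by (simp add: sigma_eq simple_root_nth)

lemma form_sigma_sigma: "form B (sigma s x) (sigma s y) = form B x y"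
  by (simp add: sigma_eq form_linear B_diag form_commute[of "simple_root s"] algebra_simps)

lemma sigma_sigma [simp]: "sigma s (sigma s x) = x"
  by (simp add: sigma_eq form_linear B_diag algebra_simps)

lemma form_sigma_left: "form B (sigma s x) y = form B x (sigma s y)"
  using form_sigma_sigma[of s x "sigma s y"] by simp

lemma sigma_simple_root: "sigma s (simple_root s) = - simple_root s"
  by (simp add: sigma_eq B_diag scaleR_2)

lemma linear_sigma: "linear (sigma s)"
  by (rule linearI) (simp_all add: sigma_eq form_linear algebra_simps scaleR_add_left)

lemma linear_act: "linear (act xs)"
proof (induction xs)
  case (Cons s xs)
  then show ?case using linear_compose[OF Cons linear_sigma[of s]] by (simp add: o_def)
qed (simp add: linear_id[unfolded id_def] linear_iff)

lemma form_act_act: "form B (act xs x) (act xs y) = form B x y"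
  by (induction xs) (auto simp: form_sigma_sigma)

lemma act_rev_act [simp]: "act (rev xs) (act xs x) = x"
  by (induction xs arbitrary: x) auto

lemma act_act_rev [simp]: "act xs (act (rev xs) x) = x"
  using act_rev_act[of "rev xs"] by simp

lemma form_act_left: "form B (act xs x) y = form B x (act (rev xs) y)"
  using form_act_act[of xs x "act (rev xs) y"] by simp

lemma act_cancel: "act (xs @ [s] @ s # ys) = act (xs @ ys)"
  by (rule ext) simp


section \<open>Positive and negative roots\<close>

lemma braid_relation:
  assumes "(sigma t \<circ> sigma s) ^^ k = id"
  shows "act (alternating s t k) = act (alternating t s k)"
proof -
  \<comment> \<open>The relation equates the empty word with the alternating word of length 2 * k.
    Cancelling the letters of the latter one by one from the left builds up the other side; the two
    meet at j = k.\<close>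
  have "act (alternating s t j) = act (alternating t s (2 * k - j))" if "j \<le> 2 * k" for j
    using that
  proof (induction j)
    case 0
    show ?case using assms by (auto simp: foldr_alternating fun_eq_iff)
  next
    case (Suc j)
    define i where "i = 2 * k - Suc j"
    have i: "2 * k - j = Suc i" "even i \<longleftrightarrow> odd j"
      using Suc.prems by (auto simp: i_def)
    have "act (alternating s t (Suc j)) = sigma (if even j then t else s) \<circ> act (alternating s t j)"
      by auto
    also have "\<dots> = sigma (if even j then t else s) \<circ> act (alternating t s (Suc i))"
      using Suc.IH Suc.prems i(1) by (simp del: alternating.simps)
    also have "\<dots> = act (alternating t s i)"
      using i(2) by (auto simp: fun_eq_iff)
    finally show ?case by (simp add: i_def)
  qed
  from this[of k] show ?thesis by simp
qed

text \<open>Each further reflection changes only one of the two coefficients b, replacing it by 2 *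
  (- \<open>B $ s $ t\<close>) * a - b with a the other one. This is the Chebyshev
  recursion.\<close>

lemma act_alternating_simple_root:
  fixes s t defines "p \<equiv> chebyshev_U (- B $ s $ t)"
  shows "act (alternating s t k) (simple_root s) =
    (if even k then p (Suc k) *\<^sub>R simple_root s + p k *\<^sub>R simple_root t
     else p k *\<^sub>R simple_root s + p (Suc k) *\<^sub>R simple_root t)"
proof (induction k)
  case 0
  show ?case by (simp add: p_def)
next
  case (Suc k)
  have "p (Suc (Suc k)) = 2 * (- B $ s $ t) * p (Suc k) - p k"
    by (simp add: p_def)
  with Suc show ?case
    by (auto simp: sigma_eq form_linear B_diag B_sym[of t s] algebra_simps scaleR_2 simp flip: scaleR_add_left)
qed

text \<open>Word length with respect to the simple reflections, measured on linear maps, so that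
  words with the same action are identified.\<close>

definition len :: "(real ^ 's \<Rightarrow> real ^ 's) \<Rightarrow> nat" where
  "len f = (LEAST n. \<exists>xs. length xs = n \<and> act xs = f)"

lemma len_le: "len (act xs) \<le> length xs"
  unfolding len_def by (rule Least_le) auto

lemma len_witness: obtains ys where "length ys = len (act xs)" "act ys = act xs"
proof -
  have "\<exists>ys. length ys = len (act xs) \<and> act ys = act xs"
    unfolding len_def by (rule LeastI_ex) auto
  then show ?thesis using that by blast
qed

lemma len_append_le: "len (act (xs @ ys)) \<le> len (act xs) + length ys"
proof -
  obtain zs where zs: "length zs = len (act xs)" "act zs = act xs"
    by (rule len_witness)
  then have "act (xs @ ys) = act (zs @ ys)" by (simp add: fun_eq_iff)
  then show ?thesis using len_le[of "zs @ ys"] zs by simp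
qed

text \<open>Induction on length through a rank-two coset: split off a longest alternating tail in
  \<open>s\<close> and \<open>t\<close>. The remaining word is shortened by neither letter, so the
  induction hypothesis makes its values on both simple roots nonnegative. The tail sends the simple
  root of \<open>s\<close> to a nonnegative combination of these two roots.\<close>

lemma act_simple_root_nonneg:
  "len (act xs) \<le> len (act (xs @ [s])) \<Longrightarrow> 0 \<le> act xs (simple_root s)"
proof (induction "len (act xs)" arbitrary: xs s rule: less_induct)
  case less
  let ?n = "len (act xs)"
  obtain ys where ys: "length ys = ?n" "act ys = act xs" by (rule len_witness)
  show ?case
  proof (cases ys rule: rev_cases)
    case Nil
    then show ?thesis using ys by (metis foldr_Nil id_apply simple_root_nonneg)
  next
    case (snoc zs t)
    have "act (xs @ [t]) = act (ys @ [t])" using ys(2) by (simp add: fun_eq_iff)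
    also have "\<dots> = act zs" by (simp add: snoc fun_eq_iff)
    finally have xs_zs: "act (xs @ [t]) = act zs" .
    have "len (act zs) < ?n"
      using len_le[of zs] ys snoc by simp
    then have "s \<noteq> t" using less.prems xs_zs by auto
    \<comment> \<open>Splittings into a head and an alternating tail with additive lengths. The last
      letter of a shortest word gives \<open>P 1\<close>; below, \<open>k\<close> is the largest
      possible tail length.\<close>
    define P where
      "P k \<longleftrightarrow> (\<exists>vs. act xs = act (vs @ alternating s t k) \<and> len (act vs) + k = ?n)" for k
    have "?n \<le> len (act zs) + 1"
      using len_append_le[of zs "[t]"] ys(2) snoc by simp
    then have "P 1"
      unfolding P_def using ys(2) snoc \<open>len (act zs) < ?n\<close> by (intro exI[of _ zs]) auto
    have bound: "P k \<Longrightarrow> k \<le> ?n" for k by (auto simp: P_def)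
    define k where "k = Greatest P"
    have "P k" unfolding k_def by (rule GreatestI_nat[of P, OF \<open>P 1\<close>]) (use bound in blast)
    have "1 \<le> k" unfolding k_def by (rule Greatest_le_nat[of P, OF \<open>P 1\<close>]) (use bound in blast)
    have "\<not> P (Suc k)"
      using Greatest_le_nat[of P "Suc k" ?n] bound by (auto simp: k_def)
    obtain vs where vs: "act xs = act (vs @ alternating s t k)" "len (act vs) + k = ?n"
      using \<open>P k\<close> by (auto simp: P_def)
    \<comment> \<open>This letter would extend the tail on the left. If it shortened the head, it
      could be moved into the tail, against the maximality of \<open>k\<close>.\<close>
    have next_letter: "len (act vs) \<le> len (act (vs @ [if even k then t else s]))"
    proof (rule ccontr)
      let ?r = "if even k then t else s"
      assume shorter: "\<not> ?thesis"
      have eq: "act xs = act ((vs @ [?r]) @ alternating s t (Suc k))"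
        using vs(1) act_cancel[of vs ?r "alternating s t k"] by simp
      have "?n \<le> len (act (vs @ [?r])) + Suc k"
        using len_append_le[of "vs @ [?r]" "alternating s t (Suc k)"] unfolding eq by simp
      then have "P (Suc k)"
        unfolding P_def using shorter vs(2) eq by (intro exI[of _ "vs @ [?r]"] conjI) auto
      with \<open>\<not> P (Suc k)\<close> show False ..
    qed
    \<comment> \<open>This is the first letter of the tail. If it shortened the head, absorbing it
      there would write \<open>act xs\<close> with fewer than \<open>?n\<close> letters.\<close>
    have first_letter: "len (act vs) \<le> len (act (vs @ [if even k then s else t]))"
    proof (rule ccontr)
      let ?r = "if even k then s else t"
      assume shorter: "\<not> ?thesis"
      obtain j where j: "k = Suc j" using \<open>1 \<le> k\<close> by (cases k) auto
      have eq: "act xs = act ((vs @ [?r]) @ alternating s t j)"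
        using vs(1) j by (auto simp: fun_eq_iff)
      have "?n \<le> len (act (vs @ [?r])) + j"
        using len_append_le[of "vs @ [?r]" "alternating s t j"] unfolding eq by simp
      then show False using shorter vs(2) j by simp
    qed
    have "len (act vs) < ?n" using vs(2) \<open>1 \<le> k\<close> by simp
    then have v: "0 \<le> act vs (simple_root s)" "0 \<le> act vs (simple_root t)"
      using next_letter first_letter less.hyps[of vs s] less.hyps[of vs t]
      by (auto split: if_splits)
    define p where "p = chebyshev_U (- B $ s $ t)"
    have p: "0 \<le> p k \<and> 0 \<le> p (Suc k)"
    proof (cases "B $ s $ t \<le> -1")
      case True
      then show ?thesis by (simp add: p_def chebyshev_U_nonneg del: chebyshev_U.simps)
    next
      case False
      then obtain j where j: "2 \<le> j" "B $ s $ t = - cos (pi / real j)"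
          "(sigma t \<circ> sigma s) ^^ j = id"
        using dihedral[of t s] \<open>s \<noteq> t\<close> by (auto simp: B_sym[of t s])
      \<comment> \<open>A tail of length at least \<open>j\<close> would contain a full braid word.
        Rewriting it to end in \<open>s\<close> shows that appending \<open>s\<close> shortens
        \<open>xs\<close>, against the premise.\<close>
      have "k < j"
      proof (rule ccontr)
        assume "\<not> k < j"
        then obtain us where us: "length us = k - j" "alternating s t k = us @ alternating s t j"
          using alternating_suffix[of j k s t] by auto
        obtain i where i: "j = Suc i" using j(1) by (cases j) auto
        have "act (alternating s t j) = act (alternating s t i @ [s])"
          using braid_relation[OF j(3)] unfolding i alternating_Suc_snoc[of t s i] .
        then have "act xs = act (vs @ us @ alternating s t i @ [s])"
          using vs(1) us(2) by (simp add: fun_eq_iff)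
        then have "act (xs @ [s]) = act (vs @ us @ alternating s t i)"
          by (simp add: fun_eq_iff)
        then have "len (act (xs @ [s])) \<le> len (act vs) + (k - j) + i"
          using len_append_le[of vs "us @ alternating s t i"] us(1) by simp
        then show False using less.prems vs(2) \<open>\<not> k < j\<close> i by simp
      qed
      then show ?thesis
        using j by (simp add: p_def chebyshev_U_cos_nonneg del: chebyshev_U.simps)
    qed
    have "act xs (simple_root s) = act vs (act (alternating s t k) (simple_root s))"
      using vs(1) by simp
    also have "\<dots> = (if even k
        then p (Suc k) *\<^sub>R act vs (simple_root s) + p k *\<^sub>R act vs (simple_root t)
        else p k *\<^sub>R act vs (simple_root s) + p (Suc k) *\<^sub>R act vs (simple_root t))"
      unfolding act_alternating_simple_root p_def
      by (simp add: linear_add[OF linear_act] linear_scale[OF linear_act] del: chebyshev_U.simps)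
    finally show ?thesis using v p by (simp add: scaleR_nonneg_nonneg)
  qed
qed

section \<open>Roots and their signs\<close>

definition root_set :: "(real ^ 's) set" where
  "root_set = {act xs (simple_root s) | xs s. True}"

lemma simple_root_in_root_set: "simple_root s \<in> root_set"
  unfolding root_set_def by (intro CollectI exI[of _ "[]"] exI[of _ s]) auto

lemma act_in_root_set: "\<gamma> \<in> root_set \<Longrightarrow> act xs \<gamma> \<in> root_set"
proof -
  assume "\<gamma> \<in> root_set"
  then obtain ys s where "\<gamma> = act ys (simple_root s)" by (auto simp: root_set_def)
  then have "act xs \<gamma> = act (xs @ ys) (simple_root s)" by simp
  then show ?thesis unfolding root_set_def by blast
qed

lemma sigma_in_root_set: "\<gamma> \<in> root_set \<Longrightarrow> sigma s \<gamma> \<in> root_set"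
  using act_in_root_set[of \<gamma> "[s]"] by simp

lemma uminus_in_root_set: "\<gamma> \<in> root_set \<Longrightarrow> - \<gamma> \<in> root_set"
proof -
  assume "\<gamma> \<in> root_set"
  then obtain xs s where "\<gamma> = act xs (simple_root s)" by (auto simp: root_set_def)
  then have "- \<gamma> = act (xs @ [s]) (simple_root s)"
    by (simp add: sigma_simple_root linear_neg[OF linear_act])
  then show ?thesis unfolding root_set_def by blast
qed

lemma form_root [simp]: "\<gamma> \<in> root_set \<Longrightarrow> form B \<gamma> \<gamma> = 1"
  by (auto simp: root_set_def form_act_act B_diag)

lemma root_nonzero: "\<gamma> \<in> root_set \<Longrightarrow> \<gamma> \<noteq> 0"
  using form_root by fastforce

text \<open>Of the words \<open>xs\<close> and \<open>xs @ [s]\<close>, at least one is not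
  shortened by appending \<open>s\<close>, and the roots they give are negatives of each
  other.\<close>

lemma root_nonneg_or_nonpos: "\<gamma> \<in> root_set \<Longrightarrow> 0 \<le> \<gamma> \<or> 0 \<le> - \<gamma>"
proof -
  assume "\<gamma> \<in> root_set"
  then obtain xs s where \<gamma>: "\<gamma> = act xs (simple_root s)" by (auto simp: root_set_def)
  have "act ((xs @ [s]) @ [s]) = act xs" by (simp add: fun_eq_iff)
  then have "0 \<le> act (xs @ [s]) (simple_root s)" if "len (act (xs @ [s])) \<le> len (act xs)"
    using act_simple_root_nonneg[of "xs @ [s]" s] that by simp
  then show ?thesis
    using act_simple_root_nonneg[of xs s] linear_neg[OF linear_act, of xs "simple_root s"]
    by (cases "len (act xs) \<le> len (act (xs @ [s]))") (auto simp: \<gamma> sigma_simple_root)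
qed

lemma root_nonneg_if_coordinate_pos: "\<gamma> \<in> root_set \<Longrightarrow> 0 < \<gamma> $ s \<Longrightarrow> 0 \<le> \<gamma>"
  using root_nonneg_or_nonpos[of \<gamma>] by (force simp: vec_nonneg_iff dest: spec[of _ s])

lemma nonneg_root_multiple_eq:
  assumes "\<gamma> \<in> root_set" "\<delta> \<in> root_set" "0 \<le> \<gamma>" "0 \<le> \<delta>" "\<gamma> = c *\<^sub>R \<delta>"
  shows "\<gamma> = \<delta>"
proof -
  have "c * c = 1" using form_root[OF assms(1)] assms(2,5) by (simp add: form_linear)
  then have "c = 1 \<or> c = - 1" by (simp add: square_eq_1_iff)
  moreover have False if "\<gamma> = - \<delta>"
    using that assms(3,4) root_nonzero[OF assms(2)] by (metis neg_0_le_iff_le order_antisym)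
  ultimately show ?thesis using assms(5) by auto
qed

text \<open>The reflection alters only the coordinate \<open>s\<close>. A nonnegative root other
  than the simple root itself has another positive coordinate; it survives and determines the sign
  of the image.\<close>

lemma sigma_root_nonneg:
  assumes "\<gamma> \<in> root_set" "0 \<le> \<gamma>" "\<gamma> \<noteq> simple_root s"
  shows "0 \<le> sigma s \<gamma>"
proof -
  have "\<exists>t. t \<noteq> s \<and> \<gamma> $ t \<noteq> 0"
    using nonneg_root_multiple_eq[OF assms(1) simple_root_in_root_set assms(2) simple_root_nonneg]
      vec_eq_simple_root_multiple[of s \<gamma>] assms(3) by blast
  then obtain t where "t \<noteq> s" "0 < sigma s \<gamma> $ t"
    using assms(2) by (auto simp: vec_nonneg_iff sigma_nth less_le)
  then show ?thesis
    by (intro root_nonneg_if_coordinate_pos[of _ t] sigma_in_root_set assms)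
qed

section \<open>Discreteness of the root system\<close>

lemma reflection_root_eq:
  "\<gamma> \<in> root_set \<Longrightarrow> reflection B \<gamma> x = x - (2 * form B x \<gamma>) *\<^sub>R \<gamma>"
  by (simp add: reflection_def)

lemma reflection_in_root_set:
  assumes "\<gamma> \<in> root_set" "\<delta> \<in> root_set"
  shows "reflection B \<gamma> \<delta> \<in> root_set"
proof -
  obtain xs s where \<gamma>: "\<gamma> = act xs (simple_root s)" using assms by (auto simp: root_set_def)
  \<comment> \<open>The reflection in a translated simple root is the conjugate of the simple
    reflection.\<close>
  have "act xs (sigma s (act (rev xs) \<delta>)) = reflection B \<gamma> \<delta>"
    unfolding reflection_root_eq[OF assms(1)]
    by (simp add: sigma_eq[of s] \<gamma> form_act_left
        linear_diff[OF linear_act] linear_scale[OF linear_act])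
  then show ?thesis
    using act_in_root_set[OF sigma_in_root_set[OF act_in_root_set[OF assms(2)]]] by metis
qed

lemma linear_reflection_root: "\<gamma> \<in> root_set \<Longrightarrow> linear (reflection B \<gamma>)"
  by (rule linearI) (simp_all add: reflection_root_eq form_linear algebra_simps)

lemma reflection_root_involution [simp]:
  "\<gamma> \<in> root_set \<Longrightarrow> reflection B \<gamma> (reflection B \<gamma> x) = x"
  by (simp add: reflection_root_eq form_linear algebra_simps)

text \<open>A nonnegative matrix with a nonnegative inverse is monomial; if both are moreover close to the
  identity, then it is diagonal.\<close>

lemma reflections_close_imp_eq:
  assumes \<gamma>: "\<gamma> \<in> root_set" "0 \<le> \<gamma>" and \<delta>: "\<delta> \<in> root_set" "0 \<le> \<delta>"
    and M: "\<And>s. 0 < reflection B \<gamma> (reflection B \<delta> (simple_root s)) $ s"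
    and N: "\<And>s. 0 < reflection B \<delta> (reflection B \<gamma> (simple_root s)) $ s"
  shows "\<gamma> = \<delta>"
proof -
  define M where "M = reflection B \<gamma> \<circ> reflection B \<delta>"
  define N where "N = reflection B \<delta> \<circ> reflection B \<gamma>"
  have lin: "linear M" "linear N"
    by (auto simp: M_def N_def intro: linear_compose linear_reflection_root \<gamma> \<delta>)
  have NM: "N (M x) = x" for x by (simp add: M_def N_def \<gamma> \<delta>)
  have roots: "M (simple_root s) \<in> root_set" "N (simple_root s) \<in> root_set" for s
    by (simp_all add: M_def N_def reflection_in_root_set \<gamma> \<delta> simple_root_in_root_set)
  have diag: "0 < M (simple_root s) $ s" "0 < N (simple_root s) $ s" for s
    using assms by (simp_all add: M_def N_def)
  \<comment> \<open>The columns of both matrices are roots, so one positive entry makes the whole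
    column nonnegative.\<close>
  have nonneg: "0 \<le> M (simple_root s) $ t" "0 \<le> N (simple_root s) $ t" for s t
    using root_nonneg_if_coordinate_pos roots diag by (metis vec_nonneg_iff)+
  have "M (simple_root s) $ t = 0" if "t \<noteq> s" for s t
  proof -
    have "simple_root s = N (\<Sum>r\<in>UNIV. M (simple_root s) $ r *\<^sub>R simple_root r)"
      by (simp add: NM flip: simple_root_expansion)
    also have "\<dots> = (\<Sum>r\<in>UNIV. M (simple_root s) $ r *\<^sub>R N (simple_root r))"
      by (simp add: linear_sum[OF lin(2)] linear_scale[OF lin(2)])
    finally have "simple_root s = (\<Sum>r\<in>UNIV. M (simple_root s) $ r *\<^sub>R N (simple_root r))" .
    from arg_cong[OF this, of "\<lambda>v. v $ t"]
    have "(\<Sum>r\<in>UNIV. M (simple_root s) $ r * N (simple_root r) $ t) = 0"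
      using that by (simp add: simple_root_nth)
    then have "M (simple_root s) $ t * N (simple_root t) $ t = 0"
      using nonneg by (subst (asm) sum_nonneg_eq_0_iff) auto
    then show ?thesis using diag(2)[of t] by simp
  qed
  then have "M (simple_root s) = M (simple_root s) $ s *\<^sub>R simple_root s" for s
    by (rule vec_eq_simple_root_multiple)
  then have "M (simple_root s) = simple_root s" for s
    using nonneg_root_multiple_eq[OF roots(1) simple_root_in_root_set _ simple_root_nonneg] nonneg
    by (metis vec_nonneg_iff)
  \<comment> \<open>\<open>M\<close> fixes every simple root, hence \<delta>. Then both reflections
    map \<delta> to its negative, which makes \<delta> a multiple of \<gamma>.\<close>
  then have "M \<delta> = (\<Sum>s\<in>UNIV. \<delta> $ s *\<^sub>R simple_root s)"
    by (subst simple_root_expansion[of \<delta>]) (simp add: linear_sum[OF lin(1)] linear_scale[OF lin(1)])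
  then have "reflection B \<gamma> (reflection B \<delta> \<delta>) = \<delta>"
    by (simp add: M_def flip: simple_root_expansion)
  then have "reflection B \<delta> \<delta> = reflection B \<gamma> \<delta>"
    by (metis \<gamma>(1) reflection_root_involution)
  then have "2 *\<^sub>R \<delta> = 2 *\<^sub>R (form B \<delta> \<gamma> *\<^sub>R \<gamma>)"
    by (simp add: reflection_root_eq \<gamma> \<delta>)
  then have "\<delta> = form B \<delta> \<gamma> *\<^sub>R \<gamma>" by (simp only: scaleR_cancel_left) simp
  then show ?thesis using nonneg_root_multiple_eq[OF \<delta>(1) \<gamma>(1) \<delta>(2) \<gamma>(2)] by metis
qed

text \<open>Infinitely many bounded roots would yield a convergent sequence of distinct nonnegative
  roots. Products of the reflections in consecutive members tend to the identity, so
  \<open>reflections_close_imp_eq\<close> makes consecutive members eventually equal.\<close>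

lemma finite_roots_norm_le: "finite {\<gamma> \<in> root_set. norm \<gamma> \<le> r}"
proof -
  define P where "P = {\<gamma> \<in> root_set. 0 \<le> \<gamma> \<and> norm \<gamma> \<le> r}"
  have "finite P"
  proof (rule ccontr)
    assume "infinite P"
    then obtain f :: "nat \<Rightarrow> real ^ 's" where f: "inj f" "range f \<subseteq> P"
      using infinite_countable_subset by blast
    have "bounded (range f)"
      using f(2) by (intro boundedI[of _ r]) (auto simp: P_def)
    then obtain l k where k: "strict_mono k" "(f \<circ> k) \<longlonglongrightarrow> l"
      using bounded_imp_convergent_subsequence by blast
    define g where "g = f \<circ> k"
    have g: "g i \<in> root_set" "0 \<le> g i" for i using f(2) by (auto simp: g_def P_def)
    have lim: "g \<longlonglongrightarrow> l" "(\<lambda>i. g (Suc i)) \<longlonglongrightarrow> l"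
      using k LIMSEQ_Suc[of g l] by (auto simp: g_def)
    have "(\<lambda>i. form B (g i) (g i)) \<longlonglongrightarrow> form B l l" by (intro tendsto_intros lim)
    then have l: "form B l l = 1" using g by (simp add: LIMSEQ_const_iff)
    have close: "\<forall>\<^sub>F i in sequentially. \<forall>s. 0 < reflection B (u i) (reflection B (v i) (simple_root s)) $ s"
      if "u \<longlonglongrightarrow> l" "v \<longlonglongrightarrow> l" "\<And>i. u i \<in> root_set" "\<And>i. v i \<in> root_set" for u v
    proof -
      \<comment> \<open>The limit is the reflection in \<open>l\<close> applied twice, which is the
        identity because \<open>l\<close> has square 1.\<close>
      have "(\<lambda>i. reflection B (u i) (reflection B (v i) x)) \<longlonglongrightarrow>
          (x - (2 * form B x l) *\<^sub>R l) - (2 * form B (x - (2 * form B x l) *\<^sub>R l) l) *\<^sub>R l" for x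
        using that(3,4) by (simp add: reflection_root_eq) (intro tendsto_intros that)
      then have lim: "(\<lambda>i. reflection B (u i) (reflection B (v i) x)) \<longlonglongrightarrow> x" for x
        by (simp add: form_linear l algebra_simps)
      have "(\<lambda>i. reflection B (u i) (reflection B (v i) (simple_root s)) $ s) \<longlonglongrightarrow> 1" for s
        using tendsto_vec_nth[OF lim[of "simple_root s"], of s] by (simp add: simple_root_nth)
      then show ?thesis
        by (intro eventually_all_finite order_tendstoD(1)[of _ 1]) auto
    qed
    have "\<forall>\<^sub>F i in sequentially. g i = g (Suc i)"
      using close[OF lim g(1) g(1)] close[OF lim(2,1) g(1) g(1)]
      by eventually_elim (auto intro: reflections_close_imp_eq g)
    then obtain i where "g i = g (Suc i)" by (auto simp: eventually_sequentially)
    then have "k i = k (Suc i)" using f(1) by (auto simp: g_def inj_def)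
    then show False using k(1) by (metis n_not_Suc_n strict_mono_eq)
  qed
  moreover have "{\<gamma> \<in> root_set. norm \<gamma> \<le> r} \<subseteq> P \<union> uminus ` P"
  proof
    fix \<gamma> assume "\<gamma> \<in> {\<gamma> \<in> root_set. norm \<gamma> \<le> r}"
    then show "\<gamma> \<in> P \<union> uminus ` P"
      using root_nonneg_or_nonpos[of \<gamma>] uminus_in_root_set[of \<gamma>]
      by (auto simp: P_def image_iff intro!: bexI[of _ "- \<gamma>"])
  qed
  ultimately show ?thesis by (meson finite_Un finite_imageI finite_subset)
qed

lemma norm_roots_at_top:
  assumes "inj \<gamma>" "range \<gamma> \<subseteq> root_set"
  shows "filterlim (\<lambda>i :: nat. norm (\<gamma> i)) at_top sequentially"
proof (subst filterlim_at_top, intro allI)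
  fix r :: real
  have "finite (\<gamma> -` {\<gamma> \<in> root_set. norm \<gamma> \<le> r})"
    by (intro finite_vimageI finite_roots_norm_le assms)
  then have "\<forall>\<^sub>F i in sequentially. i \<notin> \<gamma> -` {\<gamma> \<in> root_set. norm \<gamma> \<le> r}"
    by (simp add: eventually_cofinite flip: cofinite_eq_sequentially)
  then show "\<forall>\<^sub>F i in sequentially. r \<le> norm (\<gamma> i)"
    by eventually_elim (use assms(2) in auto)
qed

end

section \<open>The light cone\<close>

text \<open>The time direction is given by a positive linear form with no nonzero isotropic vector
  in its kernel. Positive definiteness on that kernel is deduced in
  \<open>form_pos_height_kernel\<close> and governs causal vectors from there on.\<close>

locale lorentzian_representation = reflection_representation B for B :: "real ^ 's::finite ^ 's" +
  fixes a :: "'s \<Rightarrow> real"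
  assumes a_pos: "0 < a s"
    and isotropic_kernel: "form B x x = 0 \<Longrightarrow> (\<Sum>s\<in>UNIV. a s * x $ s) = 0 \<Longrightarrow> x = 0"
    and invertible_B: "invertible B"
begin

section \<open>Height and time orientation\<close>

definition height :: "real ^ 's \<Rightarrow> real" where
  "height x = (\<Sum>s\<in>UNIV. a s * x $ s)"

lemma height_linear:
  "height (x + y) = height x + height y" "height (x - y) = height x - height y"
  "height (- x) = - height x" "height (c *\<^sub>R x) = c * height x" "height 0 = 0"
  by (simp_all add: height_def algebra_simps sum.distrib sum_subtractf sum_negf sum_distrib_left)

lemma height_simple_root: "height (simple_root s) = a s"
  by (simp add: height_def simple_root_nth if_distrib cong: if_cong)

lemma height_pos:
  assumes "0 \<le> x" "x \<noteq> 0"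
  shows "0 < height x"
proof -
  have nonneg: "0 \<le> a s * x $ s" for s
    using assms a_pos[of s] by (simp add: vec_nonneg_iff)
  then have "height x \<noteq> 0"
    using assms(2) a_pos unfolding height_def
    by (subst sum_nonneg_eq_0_iff) (auto simp: vec_eq_iff less_le)
  moreover have "0 \<le> height x" unfolding height_def by (intro sum_nonneg nonneg)
  ultimately show ?thesis by simp
qed

text \<open>For two nonzero coordinates \<open>s\<close> and \<open>t\<close> the kernel contains the space-like vector
  \<open>a t \<cdot> \<alpha> s - a s \<cdot> \<alpha> t\<close>, so by the intermediate value theorem any other sign would
  produce an isotropic vector in the kernel.\<close>

lemma form_pos_height_kernel:
  assumes "height x = 0" "x \<noteq> 0"
  shows "0 < form B x x"
proof (rule ccontr)
  assume nonpos: "\<not> ?thesis"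
  obtain s where s: "x $ s \<noteq> 0" using assms(2) by (auto simp: vec_eq_iff)
  have "\<exists>t. t \<noteq> s \<and> x $ t \<noteq> 0"
    using vec_eq_simple_root_multiple[of s x] height_linear(4) height_simple_root assms(1) s a_pos[of s]
    by (metis less_irrefl mult_eq_0_iff)
  then obtain t where t: "t \<noteq> s" by auto
  define u :: "real ^ 's" where "u = a t *\<^sub>R simple_root s - a s *\<^sub>R simple_root t"
  have "height u = 0" by (simp add: u_def height_linear height_simple_root)
  have "form B u u = (a t)\<^sup>2 + (a s)\<^sup>2 - 2 * (a s * a t * B $ s $ t)"
    by (simp add: u_def form_linear B_diag B_sym[of t s] algebra_simps power2_eq_square)
  moreover have "a s * a t * B $ s $ t \<le> 0"
    using B_offdiag[of s t] t a_pos[of s] a_pos[of t] by (simp add: mult_nonneg_nonpos)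
  moreover have "0 < (a t)\<^sup>2" using a_pos[of t] by simp
  moreover have "0 \<le> (a s)\<^sup>2" by simp
  ultimately have u: "0 < form B u u" by linarith
  define q where "q r = form B (x + r *\<^sub>R (u - x)) (x + r *\<^sub>R (u - x))" for r :: real
  have "\<exists>r\<ge>0. r \<le> 1 \<and> q r = 0"
    using nonpos u by (intro IVT') (auto simp: q_def intro!: continuous_intros)
  then obtain r where r: "0 \<le> r" "q r = 0" by blast
  \<comment> \<open>The isotropic point on the segment has height 0 and therefore vanishes. So
    \<open>x\<close> and \<open>u\<close> are proportional, which their squares of different sign
    forbid.\<close>
  have "x + r *\<^sub>R (u - x) = 0"
    using isotropic_kernel[of "x + r *\<^sub>R (u - x)"] r(2) assms(1) \<open>height u = 0\<close>
    unfolding q_def height_def[symmetric] by (simp add: height_linear)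
  then have eq: "r *\<^sub>R u = (r - 1) *\<^sub>R x" by (simp add: algebra_simps add_eq_0_iff)
  have "r \<noteq> 0" using eq assms(2) by auto
  have "r * r * form B u u = (r - 1) * (r - 1) * form B x x"
    using arg_cong[OF eq, of "\<lambda>v. form B v v"] by (simp add: form_linear mult.assoc)
  moreover have "0 < r * r * form B u u" using u \<open>r \<noteq> 0\<close> r(1) by simp
  moreover have "(r - 1) * (r - 1) * form B x x \<le> 0"
    using nonpos by (intro mult_nonneg_nonpos) auto
  ultimately show False by linarith
qed

lemma causal_height_nonzero: "form B x x \<le> 0 \<Longrightarrow> x \<noteq> 0 \<Longrightarrow> height x \<noteq> 0"
  using form_pos_height_kernel by force

text \<open>The reverse Cauchy-Schwarz inequality. The combination \<open>z\<close> of the two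
  vectors with height 0 has nonnegative square, and expanding it bounds the mixed term; if that term
  is 0, then \<open>z\<close> is 0.\<close>

lemma causal_form:
  assumes "form B x x \<le> 0" "form B y y \<le> 0" "0 < height x" "0 < height y"
  shows "form B x y \<le> 0" "form B x y = 0 \<Longrightarrow> height y *\<^sub>R x = height x *\<^sub>R y"
proof -
  define z where "z = height y *\<^sub>R x - height x *\<^sub>R y"
  have "height z = 0" by (simp add: z_def height_linear)
  then have z: "0 \<le> form B z z" "form B z z = 0 \<Longrightarrow> z = 0"
    using form_pos_height_kernel[of z] by (cases "z = 0"; force)+
  have eq: "form B z z = (height y)\<^sup>2 * form B x x + (height x)\<^sup>2 * form B y y
      - 2 * (height x * height y) * form B x y"
    by (simp add: z_def form_linear form_commute[of y x] algebra_simps power2_eq_square)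
  have nonpos: "(height y)\<^sup>2 * form B x x \<le> 0" "(height x)\<^sup>2 * form B y y \<le> 0"
    using assms by (simp_all add: mult_nonneg_nonpos)
  then have "(height x * height y) * form B x y \<le> 0" using eq z(1) by linarith
  then show "form B x y \<le> 0" using assms(3,4) by (simp add: mult_le_0_iff)
  assume "form B x y = 0"
  then have "form B z z = 0" using eq z(1) nonpos by simp
  then show "height y *\<^sub>R x = height x *\<^sub>R y" using z(2) by (simp add: z_def)
qed

text \<open>If the image were past, its negative would pair nonpositively with \<open>x\<close>.
  This forces \<open>x\<close> to be orthogonal to the simple root, hence fixed, a
  contradiction.\<close>

lemma sigma_future:
  assumes "form B x x \<le> 0" "0 < height x"
  shows "0 < height (sigma s x)"
proof (rule ccontr)
  assume "\<not> ?thesis"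
  moreover have "sigma s x \<noteq> 0"
  proof
    assume "sigma s x = 0"
    then have "x = 0" using sigma_sigma[of s x] linear_0[OF linear_sigma[of s]] by simp
    then show False using assms(2) by (simp add: height_linear)
  qed
  ultimately have "0 < height (- sigma s x)"
    using causal_height_nonzero[of "sigma s x"] assms(1) by (force simp: form_sigma_sigma height_linear)
  then have "form B x (- sigma s x) \<le> 0"
    using assms causal_form(1)[of x "- sigma s x"] by (simp add: form_linear form_sigma_sigma)
  then have "2 * (form B x (simple_root s))\<^sup>2 \<le> form B x x"
    by (simp add: sigma_eq form_linear power2_eq_square)
  then have "(form B x (simple_root s))\<^sup>2 \<le> 0" using assms(1) by linarith
  then have "form B x (simple_root s) = 0" by simp
  with \<open>\<not> ?thesis\<close> assms(2) show False by (simp add: sigma_eq)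
qed

lemma act_future:
  assumes "form B x x \<le> 0" "0 < height x"
  shows "0 < height (act xs x)"
proof (induction xs)
  case (Cons s xs)
  then show ?case using sigma_future[of "act xs x" s] assms(1) by (simp add: form_act_act)
qed (use assms in simp)

section \<open>Fundamental weights\<close>

lemma form_simple_root_fundamental_weight:
  "form B (simple_root s) (fundamental_weight B t) = (if s = t then 1 else 0)"
proof -
  have nth: "form B (simple_root s) w = (B *v w) $ s" for s w
    by (simp add: form_def simple_root_def inner_axis')
  have iff: "(\<forall>s. form B (simple_root s) w = (if s = t then 1 else 0)) \<longleftrightarrow> B *v w = simple_root t" for w
    by (simp add: nth vec_eq_iff simple_root_nth)
  obtain C where C: "B ** C = mat 1" "C ** B = mat 1"
    using invertible_B by (auto simp: invertible_def)
  \<comment> \<open>The fundamental weight is column \<open>t\<close> of the inverse matrix;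
    uniqueness resolves the definite description.\<close>
  have "\<exists>!w. B *v w = simple_root t"
  proof
    show "B *v (C *v simple_root t) = simple_root t"
      by (simp add: matrix_vector_mul_assoc C)
    show "w = C *v simple_root t" if "B *v w = simple_root t" for w
      by (simp add: matrix_vector_mul_assoc C flip: that)
  qed
  from theI'[OF this] show ?thesis
    unfolding fundamental_weight_def iff using iff by metis
qed

text \<open>This translates ball conditions into signs of coordinates: pairing a translated weight
  with \<open>y\<close> reads off a coordinate of the inversely translated \<open>y\<close>.\<close>

lemma form_fundamental_weight: "form B (fundamental_weight B t) x = x $ t"
  by (subst form_commute, subst form_expand_left)
    (simp add: form_simple_root_fundamental_weight if_distrib cong: if_cong)

text \<open>The positive part of the weight is a causal vector orthogonal to it, hence zero or proportional
  to it.\<close>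

lemma fundamental_weight_nonpos:
  assumes "form B (fundamental_weight B t) (fundamental_weight B t) \<le> 0"
  shows "0 \<le> - fundamental_weight B t"
proof (rule ccontr)
  assume neg: "\<not> ?thesis"
  define w where "w = fundamental_weight B t"
  define p where "p = (\<chi> s. max (w $ s) 0)"
  define q where "q = (\<chi> s. max (- w $ s) 0)"
  have w: "w = p - q" by (auto simp: vec_eq_iff p_def q_def)
  have pq: "0 \<le> p" "0 \<le> q" by (simp_all add: vec_nonneg_iff p_def q_def)
  \<comment> \<open>The square of the weight is its own coordinate \<open>t\<close>. As this is
    nonpositive, \<open>p\<close> vanishes at \<open>t\<close> and is orthogonal to
    \<open>w\<close>.\<close>
  have wt: "w $ t \<le> 0"
    using assms form_fundamental_weight[of t w] by (simp add: w_def)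
  then have wp: "form B w p = 0"
    by (simp add: w_def form_fundamental_weight p_def)
  \<comment> \<open>\<open>p\<close> and \<open>q\<close> have disjoint supports, so only
    off-diagonal entries contribute.\<close>
  have "form B q p = (\<Sum>s\<in>UNIV. \<Sum>r\<in>UNIV. q $ s * (B $ s $ r * p $ r))"
    by (simp add: form_expand_left[of B q] form_simple_root_left sum_distrib_left)
  also have "\<dots> \<le> 0"
  proof (intro sum_nonpos)
    fix s r
    show "q $ s * (B $ s $ r * p $ r) \<le> 0"
    proof (cases "s = r")
      case True
      then show ?thesis by (auto simp: p_def q_def max_def)
    next
      case False
      then show ?thesis
        using pq B_offdiag[of s r]
        by (intro mult_nonneg_nonpos mult_nonpos_nonneg) (auto simp: vec_nonneg_iff)
    qed
  qed
  finally have p_causal: "form B p p \<le> 0"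
    using wp by (simp add: w form_linear)
  have "p \<noteq> 0" using neg w pq by (auto simp: w_def)
  then have hp: "0 < height p" using pq height_pos by blast
  have ww: "form B w w \<le> 0" using assms by (simp add: w_def)
  have "w \<noteq> 0" using form_simple_root_fundamental_weight[of t t] by (auto simp: w_def)
  then consider "0 < height w" | "0 < height (- w)"
    using causal_height_nonzero[OF ww] by (force simp: height_linear)
  then show False
  proof cases
    case 1
    then have "height w *\<^sub>R p = height p *\<^sub>R w"
      using causal_form(2)[OF ww p_causal 1 hp wp] by simp
    then have "0 \<le> height p *\<^sub>R w"
      using 1 pq by (metis less_imp_le scaleR_nonneg_nonneg)
    \<comment> \<open>Now \<open>w\<close> is nonnegative with coordinate 0 at \<open>t\<close>, so
      its pairing with the simple root of \<open>t\<close> involves only off-diagonal entries and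
      cannot be 1.\<close>
    then have nonneg: "0 \<le> w $ s" for s
      using hp by (simp add: vec_nonneg_iff zero_le_mult_iff)
    then have "w $ t = 0" using wt by (simp add: antisym)
    have "form B (simple_root t) w \<le> 0"
      unfolding form_simple_root_left
    proof (intro sum_nonpos)
      fix s
      show "B $ t $ s * w $ s \<le> 0"
        using B_offdiag[of t s] nonneg[of s] \<open>w $ t = 0\<close>
        by (cases "s = t") (auto intro: mult_nonpos_nonneg)
    qed
    then show False by (simp add: w_def form_simple_root_fundamental_weight)
  next
    case 2
    then have "height p *\<^sub>R (- w) = height (- w) *\<^sub>R p"
      using causal_form(2)[of "- w" p] ww p_causal hp wp by (simp add: form_linear)
    then have "0 \<le> height p *\<^sub>R (- w)"
      using 2 pq by (metis less_imp_le scaleR_nonneg_nonneg)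
    then have "0 \<le> - w $ s" for s
      using hp by (simp add: vec_nonneg_iff mult_le_0_iff)
    then have "p = 0" by (simp add: p_def vec_eq_iff max_def antisym)
    with \<open>p \<noteq> 0\<close> show False ..
  qed
qed

end

section \<open>Limits of lines\<close>

lemma span_eq_imp_multiple:
  fixes x y :: "'v::real_normed_vector"
  assumes "span {x} = span {y}" "x \<noteq> 0"
  obtains c where "c \<noteq> 0" "x = c *\<^sub>R y"
proof -
  have "x \<in> span {y}" using assms(1) span_base[of x "{x}"] by simp
  then obtain c where "x = c *\<^sub>R y" by (auto simp: span_singleton)
  with assms(2) that show ?thesis by (cases "c = 0") auto
qed

lemma span_scaleR: "c \<noteq> 0 \<Longrightarrow> span {c *\<^sub>R y} = span {y :: 'v::real_normed_vector}"
  using span_image_scale[of "{y}" "\<lambda>_. c"] by simp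

lemma limitin_proj_topology_span:
  fixes x :: "'v::real_normed_vector"
  assumes "(f \<longlongrightarrow> x) F" "x \<noteq> 0"
  shows "limitin proj_topology (\<lambda>i. span {f i}) (span {x}) F"
  unfolding limitin_def
proof (intro conjI allI impI)
  show "span {x} \<in> topspace proj_topology"
    using assms(2) by (auto simp: topspace_proj_topology proj_space_def)
  fix U :: "'v set set"
  assume "openin proj_topology U \<and> span {x} \<in> U"
  then have "open {y. y \<noteq> 0 \<and> span {y} \<in> U}" "x \<in> {y. y \<noteq> 0 \<and> span {y} \<in> U}"
    using assms(2) by (auto simp: openin_proj_topology)
  from topological_tendstoD[OF assms(1) this]
  show "\<forall>\<^sub>F i in F. span {f i} \<in> U" by eventually_elim auto
qed

text \<open>A closed set stable under nonzero scalars corresponds to a closed set of lines. Choosing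
  suitable cones extracts information from a limit of lines without normalising
  representatives.\<close>

lemma limitin_proj_topology_closed_cone:
  fixes x :: "'v::real_normed_vector"
  assumes lim: "limitin proj_topology (\<lambda>i. span {f i}) (span {x}) F"
    and "x \<noteq> 0" "F \<noteq> bot" "closed C"
    and cone: "\<And>c y. c \<noteq> 0 \<Longrightarrow> y \<in> C \<Longrightarrow> c *\<^sub>R y \<in> C"
    and C: "\<forall>\<^sub>F i in F. f i \<in> C" and nonzero: "\<And>i. f i \<noteq> 0"
  shows "x \<in> C"
proof (rule ccontr)
  assume "x \<notin> C"
  define U where "U = {span {y} | y. y \<noteq> 0 \<and> y \<notin> C}"
  have mem: "span {y} \<in> U \<longleftrightarrow> y \<notin> C" if "y \<noteq> 0" for y
  proof
    assume "span {y} \<in> U"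
    then obtain z where z: "span {z} = span {y}" "z \<noteq> 0" "z \<notin> C" by (auto simp: U_def)
    then obtain c where "c \<noteq> 0" "z = c *\<^sub>R y" by (metis span_eq_imp_multiple)
    then show "y \<notin> C" using cone z(3) by blast
  qed (use that in \<open>auto simp: U_def\<close>)
  have "{y. y \<noteq> 0 \<and> span {y} \<in> U} = - {0} \<inter> - C" using mem by auto
  moreover have "U \<subseteq> proj_space" by (auto simp: U_def proj_space_def)
  ultimately have "openin proj_topology U"
    using \<open>closed C\<close> by (simp add: openin_proj_topology open_Int open_Compl)
  moreover have "span {x} \<in> U" using mem \<open>x \<noteq> 0\<close> \<open>x \<notin> C\<close> by blast
  ultimately have "\<forall>\<^sub>F i in F. span {f i} \<in> U" using lim by (auto simp: limitin_def)
  then have "\<forall>\<^sub>F i in F. f i \<notin> C" using mem nonzero by simp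
  with C have "\<forall>\<^sub>F i in F. False" by eventually_elim simp
  then show False using \<open>F \<noteq> bot\<close> by simp
qed


section \<open>Limit roots\<close>

context lorentzian_representation
begin

text \<open>Roots have square 1 while their norms tend to infinity, so they eventually enter every
  cone where the absolute square is at most e times the squared norm. The limit lies in all these
  cones.\<close>

lemma limit_root_isotropic:
  assumes "inj \<gamma>" "range \<gamma> \<subseteq> root_set" "x \<noteq> 0"
    and lim: "limitin proj_topology (\<lambda>i. span {\<gamma> i}) (span {x}) sequentially"
  shows "form B x x = 0"
proof -
  have bound: "\<bar>form B x x\<bar> \<le> e * (norm x)\<^sup>2" if "0 < e" for e
  proof -
    define C where "C = {y :: real ^ 's. \<bar>form B y y\<bar> \<le> e * (norm y)\<^sup>2}"
    have "closed C"
      unfolding C_def by (intro closed_Collect_le continuous_intros)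
    moreover have "c *\<^sub>R y \<in> C" if "y \<in> C" for c y
    proof -
      have "\<bar>form B (c *\<^sub>R y) (c *\<^sub>R y)\<bar> = c\<^sup>2 * \<bar>form B y y\<bar>"
        by (simp add: form_linear abs_mult power2_eq_square flip: mult.assoc)
      also have "\<dots> \<le> c\<^sup>2 * (e * (norm y)\<^sup>2)"
        using that by (intro mult_left_mono) (simp_all add: C_def)
      also have "\<dots> = e * (norm (c *\<^sub>R y))\<^sup>2"
        by (simp add: power_mult_distrib)
      finally show ?thesis by (simp add: C_def)
    qed
    moreover have "\<forall>\<^sub>F i in sequentially. max 1 (1 / e) \<le> norm (\<gamma> i)"
      using norm_roots_at_top[OF assms(1,2)] by (simp only: filterlim_at_top)
    then have "\<forall>\<^sub>F i in sequentially. \<gamma> i \<in> C"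
    proof eventually_elim
      case (elim i)
      then have "1 / e \<le> norm (\<gamma> i) * norm (\<gamma> i)"
        by (smt (verit) mult_left_le_imp_le mult_le_cancel_left1 norm_ge_zero)
      then have "1 \<le> e * (norm (\<gamma> i))\<^sup>2"
        using \<open>0 < e\<close> by (simp add: power2_eq_square field_simps)
      then show "\<gamma> i \<in> C" using assms(2) by (simp add: C_def range_subsetD)
    qed
    moreover have "\<gamma> i \<noteq> 0" for i using assms(2) root_nonzero by blast
    ultimately have "x \<in> C"
      using limitin_proj_topology_closed_cone[OF lim \<open>x \<noteq> 0\<close>, of C] by simp
    then show ?thesis by (simp add: C_def)
  qed
  show ?thesis
  proof (rule ccontr)
    assume "form B x x \<noteq> 0"
    then have "0 < \<bar>form B x x\<bar> / (2 * (norm x)\<^sup>2)" using \<open>x \<noteq> 0\<close> by simp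
    from bound[OF this] \<open>form B x x \<noteq> 0\<close> \<open>x \<noteq> 0\<close> show False by simp
  qed
qed

text \<open>The cone of vectors that \<open>act xs\<close> makes nonnegative or nonpositive is
  closed and contains all roots, since translates of roots are roots.\<close>

lemma limit_root_orbit_nonneg:
  assumes "range \<gamma> \<subseteq> root_set" "x \<noteq> 0"
    and lim: "limitin proj_topology (\<lambda>i. span {\<gamma> i}) (span {x}) sequentially"
  shows "0 \<le> act xs x \<or> 0 \<le> - act xs x"
proof -
  define C where "C = act xs -` ({v. 0 \<le> v} \<union> {v. 0 \<le> - v})"
  have "closed ({v. 0 \<le> v} \<union> {v. 0 \<le> - v} :: (real ^ 's) set)"
    unfolding vec_nonneg_iff
    by (intro closed_Un closed_Collect_all closed_Collect_le continuous_intros)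
  then have "closed C"
    unfolding C_def
    by (intro closed_vimage linear_continuous_on linear_conv_bounded_linear[THEN iffD1] linear_act)
  moreover have "c *\<^sub>R y \<in> C" if "y \<in> C" for c y
    using that by (cases "0 \<le> c")
      (auto simp: C_def linear_scale[OF linear_act] vec_nonneg_iff zero_le_mult_iff mult_le_0_iff)
  moreover have "\<gamma> i \<in> C" for i
    using root_nonneg_or_nonpos[OF act_in_root_set[of "\<gamma> i" xs]] assms(1) by (auto simp: C_def)
  moreover have "\<gamma> i \<noteq> 0" for i using assms(1) root_nonzero by blast
  ultimately have "x \<in> C"
    using limitin_proj_topology_closed_cone[OF lim \<open>x \<noteq> 0\<close>, of C] by simp
  then show ?thesis by (auto simp: C_def)
qed

text \<open>Normalised, infinitely many such roots accumulate at a future isotropic \<open>z\<close>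
  with \<open>form B y z\<close> nonnegative. Two future isotropic vectors can pair so only when
  proportional, which would make the line of \<open>y\<close> a limit root.\<close>

lemma finite_roots_form_nonneg:
  assumes "form B y y = 0" "0 < height y" "span {y} \<notin> limit_roots root_set"
  shows "finite {\<gamma> \<in> root_set. 0 \<le> \<gamma> \<and> 0 \<le> form B y \<gamma>}"
proof (rule ccontr)
  assume "infinite {\<gamma> \<in> root_set. 0 \<le> \<gamma> \<and> 0 \<le> form B y \<gamma>}"
  then obtain f :: "nat \<Rightarrow> real ^ 's"
    where f: "inj f" "range f \<subseteq> {\<gamma> \<in> root_set. 0 \<le> \<gamma> \<and> 0 \<le> form B y \<gamma>}"
    using infinite_countable_subset by blast
  then have root: "f i \<in> root_set" "0 \<le> f i" "0 \<le> form B y (f i)" for i by auto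
  have norm_pos: "0 < norm (f i)" for i using root_nonzero[OF root(1)] by simp
  define u where "u i = (1 / norm (f i)) *\<^sub>R f i" for i
  have norm_u: "norm (u i) = 1" for i using norm_pos[of i] by (simp add: u_def)
  then have "bounded (range u)" by (intro boundedI[of _ 1]) auto
  then obtain z k where k: "strict_mono k" "(u \<circ> k) \<longlonglongrightarrow> z"
    using bounded_imp_convergent_subsequence by blast
  then have lim: "(\<lambda>i. u (k i)) \<longlonglongrightarrow> z" by (simp add: o_def)
  have "(\<lambda>i. norm (u (k i))) \<longlonglongrightarrow> norm z" by (intro tendsto_intros lim)
  then have "z \<noteq> 0" by (auto simp: norm_u LIMSEQ_const_iff)
  have "0 \<le> u i $ s" for i s
    using root(2)[of i] norm_pos[of i] by (simp add: u_def vec_nonneg_iff)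
  then have "0 \<le> z"
    unfolding vec_nonneg_iff using LIMSEQ_le_const[OF tendsto_vec_nth[OF lim]] by blast
  have "0 \<le> form B y (u i)" for i
    using root(3)[of i] norm_pos[of i] by (simp add: u_def form_linear)
  then have yz: "0 \<le> form B y z"
    using LIMSEQ_le_const[OF tendsto_form[OF tendsto_const lim]] by blast
  have inj: "inj (\<lambda>i. f (k i))"
    using inj_compose[OF f(1) strict_mono_imp_inj_on[OF k(1)]] by (simp add: o_def)
  have "span {u i} = span {f i}" for i
    unfolding u_def using norm_pos[of i] by (intro span_scaleR) simp
  then have lim_span: "limitin proj_topology (\<lambda>i. span {f (k i)}) (span {z}) sequentially"
    using limitin_proj_topology_span[OF lim \<open>z \<noteq> 0\<close>] by simp
  then have "form B z z = 0"
    using limit_root_isotropic[OF inj _ \<open>z \<noteq> 0\<close>] root by auto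
  have "span {z} \<in> limit_roots root_set"
    unfolding limit_roots_def
  proof (intro CollectI conjI exI)
    show "span {z} \<in> proj_space" using \<open>z \<noteq> 0\<close> by (auto simp: proj_space_def)
    show "inj (\<lambda>i. f (k i))" by (rule inj)
    show "range (\<lambda>i. f (k i)) \<subseteq> root_set" using root by auto
    show "limitin proj_topology (\<lambda>i. span {f (k i)}) (span {z}) sequentially" by (rule lim_span)
  qed
  have hz: "0 < height z" using \<open>0 \<le> z\<close> \<open>z \<noteq> 0\<close> by (rule height_pos)
  have "form B y z = 0"
    using causal_form(1)[of y z] yz assms hz \<open>form B z z = 0\<close> by simp
  then have "height z *\<^sub>R y = height y *\<^sub>R z"
    using causal_form(2)[of y z] assms hz \<open>form B z z = 0\<close> by simp
  then have "span {y} = span {z}"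
    using span_scaleR[of "height z" y] span_scaleR[of "height y" z] hz assms(2) by simp
  with \<open>span {z} \<in> limit_roots root_set\<close> assms(3) show False by simp
qed

section \<open>Counting positive roots\<close>

lemma sigma_neq_simple_root:
  assumes "0 \<le> \<gamma>"
  shows "sigma s \<gamma> \<noteq> simple_root s"
proof
  assume "sigma s \<gamma> = simple_root s"
  then have "\<gamma> = - simple_root s" using sigma_sigma[of s \<gamma>] by (simp add: sigma_simple_root)
  then have "\<gamma> $ s = - 1" by (simp add: simple_root_nth)
  with assms show False by (metis vec_nonneg_iff neg_0_le_iff_le not_one_le_zero)
qed

text \<open>Reflecting in a simple root with positive pairing removes that root from the set and
  injects the new set into the rest, because a simple reflection permutes the other positive roots.
  The cardinality drops at every step.\<close>

lemma exists_dominant_translate: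
  assumes "finite {\<gamma> \<in> root_set. 0 \<le> \<gamma> \<and> 0 < form B y \<gamma>}"
  shows "\<exists>xs. \<forall>s. form B (act xs y) (simple_root s) \<le> 0"
  using assms
proof (induction "card {\<gamma> \<in> root_set. 0 \<le> \<gamma> \<and> 0 < form B y \<gamma>}" arbitrary: y rule: less_induct)
  case less
  define N where "N x = {\<gamma> \<in> root_set. 0 \<le> \<gamma> \<and> 0 < form B x \<gamma>}" for x
  show ?case
  proof (cases "\<forall>s. form B y (simple_root s) \<le> 0")
    case True
    then show ?thesis by (intro exI[of _ "[]"]) simp
  next
    case False
    then obtain s where s: "0 < form B y (simple_root s)" by (auto simp: not_le)
    then have mem: "simple_root s \<in> N y"
      by (simp add: N_def simple_root_in_root_set simple_root_nonneg)
    have sub: "N (sigma s y) \<subseteq> sigma s ` (N y - {simple_root s})"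
    proof
      fix \<gamma> assume \<gamma>: "\<gamma> \<in> N (sigma s y)"
      then have "\<gamma> \<noteq> simple_root s"
        using s by (auto simp: N_def form_sigma_left sigma_simple_root form_linear)
      then have "sigma s \<gamma> \<in> N y"
        using \<gamma> by (auto simp: N_def form_sigma_left sigma_in_root_set sigma_root_nonneg)
      moreover have "sigma s \<gamma> \<noteq> simple_root s"
        using \<gamma> by (intro sigma_neq_simple_root) (auto simp: N_def)
      ultimately show "\<gamma> \<in> sigma s ` (N y - {simple_root s})"
        by (intro image_eqI[of _ _ "sigma s \<gamma>"]) auto
    qed
    have fin: "finite (N y)" using less.prems by (simp add: N_def)
    then have "card (N (sigma s y)) \<le> card (N y - {simple_root s})"
      using sub by (meson card_image_le card_mono finite_Diff finite_imageI order_trans)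
    also have "\<dots> < card (N y)" using fin mem by (meson card_Diff1_less)
    finally have "card (N (sigma s y)) < card (N y)" .
    moreover have "finite (N (sigma s y))"
      using sub fin by (meson finite_Diff finite_imageI finite_subset)
    ultimately obtain xs where "\<forall>r. form B (act xs (sigma s y)) (simple_root r) \<le> 0"
      using less.hyps[of "sigma s y"] by (auto simp: N_def)
    then show ?thesis by (intro exI[of _ "xs @ [s]"]) simp
  qed
qed

text \<open>The sum \<open>\<rho>\<close> of the finitely many positive roots orthogonal to \<open>x\<close> is the analogue of the Weyl
  vector: \<open>form B \<rho> \<alpha> = 1\<close> for every simple root \<open>\<alpha>\<close> orthogonal to \<open>x\<close>.\<close>

lemma infinite_orthogonal_roots:
  assumes "0 \<le> x" "x \<noteq> 0" "form B x x = 0" "\<And>s. form B x (simple_root s) \<le> 0"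
  shows "infinite {\<gamma> \<in> root_set. 0 \<le> \<gamma> \<and> form B x \<gamma> = 0}"
proof
  define R where "R = {\<gamma> \<in> root_set. 0 \<le> \<gamma> \<and> form B x \<gamma> = 0}"
  assume "finite {\<gamma> \<in> root_set. 0 \<le> \<gamma> \<and> form B x \<gamma> = 0}"
  then have fin: "finite R" by (simp add: R_def)
  have "(\<Sum>s\<in>UNIV. - (x $ s * form B x (simple_root s))) = 0"
    using assms(3) form_expand_right[of x x] by (simp add: sum_negf)
  \<comment> \<open>The square of \<open>x\<close> is a sum of nonpositive terms equal to 0, so each
    term vanishes.\<close>
  then have zero: "x $ s * form B x (simple_root s) = 0" for s
    using assms(1,4) by (subst (asm) sum_nonneg_eq_0_iff)
      (auto simp: vec_nonneg_iff mult_nonneg_nonpos)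
  define \<rho> where "\<rho> = \<Sum>R"
  have \<rho>: "form B (simple_root s) \<rho> = 1" if "x $ s \<noteq> 0" for s
  proof -
    have orth: "form B x (simple_root s) = 0" using zero[of s] that by simp
    then have mem: "simple_root s \<in> R"
      by (simp add: R_def simple_root_in_root_set simple_root_nonneg)
    have "sigma s x = x" using orth by (simp add: sigma_eq)
    \<comment> \<open>The reflection permutes \<open>R\<close> without its own simple root, so it
      fixes the sum \<tau> of these roots, which is therefore orthogonal to that simple
      root.\<close>
    have maps: "sigma s \<gamma> \<in> R - {simple_root s}" if "\<gamma> \<in> R - {simple_root s}" for \<gamma>
    proof -
      have "form B x (sigma s \<gamma>) = 0"
        using that \<open>sigma s x = x\<close> by (simp add: R_def flip: form_sigma_left)
      moreover have "sigma s \<gamma> \<noteq> simple_root s"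
        using that by (intro sigma_neq_simple_root) (auto simp: R_def)
      ultimately show ?thesis
        using that by (simp add: R_def sigma_in_root_set sigma_root_nonneg)
    qed
    define \<tau> where "\<tau> = \<Sum>(R - {simple_root s})"
    have "sigma s \<tau> = (\<Sum>\<gamma>\<in>R - {simple_root s}. sigma s \<gamma>)"
      by (simp add: \<tau>_def linear_sum[OF linear_sigma])
    also have "\<dots> = \<tau>"
      unfolding \<tau>_def
      by (intro sum.reindex_bij_witness[of _ "sigma s" "sigma s"]) (use maps in auto)
    finally have "form B \<tau> (simple_root s) *\<^sub>R simple_root s = (0 :: real ^ 's)"
      by (simp add: sigma_eq)
    then have "form B \<tau> (simple_root s) = 0"
      using root_nonzero[OF simple_root_in_root_set[of s]] by simp
    moreover have "\<rho> = simple_root s + \<tau>"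
      unfolding \<rho>_def \<tau>_def using fin mem by (simp add: sum.remove)
    ultimately show ?thesis
      by (simp add: form_linear B_diag form_commute[of "simple_root s" \<tau>])
  qed
  have "form B x \<rho> = 0"
    unfolding \<rho>_def form_sum_right by (simp add: R_def)
  moreover have "form B x \<rho> = (\<Sum>s\<in>UNIV. x $ s)"
    unfolding form_expand_left[of B x] using \<rho> by (intro sum.cong) auto
  ultimately have "(\<Sum>s\<in>UNIV. x $ s) = 0" by simp
  then have "\<forall>s. x $ s = 0"
    using assms(1) by (subst (asm) sum_nonneg_eq_0_iff) (auto simp: vec_nonneg_iff)
  then show False using assms(2) by (simp add: vec_eq_iff)
qed

lemma residual_imp_limit_root:
  assumes y: "form B y y = 0" "0 < height y"
    and residual: "\<And>xs t. 0 < form B (fundamental_weight B t) (fundamental_weight B t) \<Longrightarrow>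
      0 \<le> act xs y $ t"
  shows "span {y} \<in> limit_roots root_set"
proof (rule ccontr)
  assume "\<not> ?thesis"
  then have fin: "finite {\<gamma> \<in> root_set. 0 \<le> \<gamma> \<and> 0 \<le> form B y \<gamma>}"
    using finite_roots_form_nonneg y by blast
  then have "finite {\<gamma> \<in> root_set. 0 \<le> \<gamma> \<and> 0 < form B y \<gamma>}"
    by (rule rev_finite_subset) auto
  then obtain xs where xs: "form B (act xs y) (simple_root s) \<le> 0" for s
    using exists_dominant_translate[of y] by blast
  define x where "x = act xs y"
  have x: "form B x x = 0" "0 < height x"
    using y act_future[of y xs] by (simp_all add: x_def form_act_act)
  have "0 \<le> x $ t" for t
  proof (cases "0 < form B (fundamental_weight B t) (fundamental_weight B t)")
    case True
    then show ?thesis unfolding x_def by (rule residual)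
  next
    case False
    let ?w = "fundamental_weight B t"
    have "0 \<le> - ?w" using False by (intro fundamental_weight_nonpos) simp
    moreover have "- ?w \<noteq> 0"
      using form_simple_root_fundamental_weight[of t t] by auto
    ultimately have "0 < height (- ?w)" by (rule height_pos)
    then have "form B (- ?w) x \<le> 0"
      using False x causal_form(1)[of "- ?w" x] by (simp add: form_linear)
    then show ?thesis by (simp add: form_linear form_fundamental_weight)
  qed
  then have "0 \<le> x" by (simp add: vec_nonneg_iff)
  moreover have "x \<noteq> 0" using x(2) height_linear(5) by auto
  ultimately have inf: "infinite {\<gamma> \<in> root_set. 0 \<le> \<gamma> \<and> form B x \<gamma> = 0}"
    using infinite_orthogonal_roots x(1) xs by (simp add: x_def)
  let ?Z = "{\<gamma> \<in> root_set. 0 \<le> \<gamma> \<and> 0 \<le> form B y \<gamma>}"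
  \<comment> \<open>Moving back to \<open>y\<close> may turn a root negative, but the pairing is 0,
    so the root or its negative lies in the finite set \<open>?Z\<close>.\<close>
  have "{\<gamma> \<in> root_set. 0 \<le> \<gamma> \<and> form B x \<gamma> = 0} \<subseteq> act xs ` (?Z \<union> uminus ` ?Z)"
  proof
    fix \<gamma> assume "\<gamma> \<in> {\<gamma> \<in> root_set. 0 \<le> \<gamma> \<and> form B x \<gamma> = 0}"
    then have \<gamma>: "act (rev xs) \<gamma> \<in> root_set" "form B y (act (rev xs) \<gamma>) = 0"
      by (simp_all add: act_in_root_set x_def form_act_left)
    then have "act (rev xs) \<gamma> \<in> ?Z \<union> uminus ` ?Z"
      using root_nonneg_or_nonpos[OF \<gamma>(1)] uminus_in_root_set[OF \<gamma>(1)]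
      by (auto simp: form_linear image_iff intro!: bexI[of _ "- act (rev xs) \<gamma>"])
    then show "\<gamma> \<in> act xs ` (?Z \<union> uminus ` ?Z)"
      by (intro image_eqI[of _ _ "act (rev xs) \<gamma>"]) simp
  qed
  then show False using inf fin by (meson finite_Un finite_imageI finite_subset)
qed

section \<open>Limit roots as the residual set\<close>

definition weight_set :: "(real ^ 's) set" where
  "weight_set = {act xs (fundamental_weight B t) | xs t. True}"

lemma future_representative:
  assumes "form B x x = 0" "x \<noteq> 0"
  obtains y where "span {y} = span {x}" "form B y y = 0" "0 < height y"
proof (cases "0 < height x")
  case True
  then show ?thesis using that assms(1) by blast
next
  case False
  then have "0 < height (- x)"
    using causal_height_nonzero[of x] assms by (auto simp: height_linear not_less less_le)
  then show ?thesis
    using that[of "- x"] assms(1) span_scaleR[of "- 1" x] by (simp add: form_linear)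
qed

theorem limit_roots_eq_residual_set:
  "limit_roots root_set =
    proj_light_cone B - (\<Union>\<omega>\<in>{\<omega> \<in> weight_set. 0 < form B \<omega> \<omega>}. ball_interior B height \<omega>)"
    (is "_ = _ - ?U")
proof (intro equalityI subsetI)
  fix p assume "p \<in> limit_roots root_set"
  then obtain \<gamma> where p: "p \<in> proj_space" and \<gamma>: "inj \<gamma>" "range \<gamma> \<subseteq> root_set"
    and lim: "limitin proj_topology (\<lambda>i. span {\<gamma> i}) p sequentially"
    by (auto simp: limit_roots_def)
  obtain x where x: "p = span {x}" "x \<noteq> 0" using p by (auto simp: proj_space_def)
  have "form B x x = 0" using limit_root_isotropic[OF \<gamma> x(2)] lim x(1) by simp
  then have "p \<in> proj_light_cone B"
    using x by (auto simp: proj_light_cone_def light_cone_def)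
  moreover have "p \<notin> ?U"
  proof
    assume "p \<in> ?U"
    then obtain xs t y where y: "p = span {y}" "form B y y = 0" "0 < height y"
        "form B (act xs (fundamental_weight B t)) y < 0"
      by (auto simp: weight_set_def ball_interior_def future_light_cone_def light_cone_def)
    \<comment> \<open>\<open>?z\<close> remains future and hence cannot be nonpositive, so it must
      be nonnegative; the ball condition says that its coordinate \<open>t\<close> is
      negative.\<close>
    let ?z = "act (rev xs) y"
    have z: "0 < height ?z" using y act_future by simp
    then have "\<not> 0 \<le> - ?z"
      using height_pos[of "- ?z"] by (cases "?z = 0") (auto simp: height_linear)
    moreover have "y \<noteq> 0" using y(3) by (auto simp: height_linear)
    ultimately have "0 \<le> ?z"
      using limit_root_orbit_nonneg[OF \<gamma>(2)] lim y(1) by blast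
    then show False
      using y(4) by (simp add: form_act_left form_fundamental_weight vec_nonneg_iff not_less[symmetric])
  qed
  ultimately show "p \<in> proj_light_cone B - ?U" by blast
next
  fix p assume p: "p \<in> proj_light_cone B - ?U"
  then obtain x where x: "p = span {x}" "form B x x = 0" "x \<noteq> 0"
    by (auto simp: proj_light_cone_def light_cone_def)
  then obtain y where y: "p = span {y}" "form B y y = 0" "0 < height y"
    using future_representative by metis
  have "0 \<le> act xs y $ t"
    if "0 < form B (fundamental_weight B t) (fundamental_weight B t)" for xs t
  proof (rule ccontr)
    let ?\<omega> = "act (rev xs) (fundamental_weight B t)"
    assume "\<not> ?thesis"
    then have "form B ?\<omega> y < 0" by (simp add: form_act_left form_fundamental_weight)
    then have "p \<in> ball_interior B height ?\<omega>"
      using y by (auto simp: ball_interior_def future_light_cone_def light_cone_def)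
    moreover have "?\<omega> \<in> weight_set" unfolding weight_set_def by blast
    moreover have "0 < form B ?\<omega> ?\<omega>" using that by (simp add: form_act_act)
    ultimately show False using p by blast
  qed
  then show "p \<in> limit_roots root_set"
    using residual_imp_limit_root y by simp
qed

end

section \<open>The Coxeter group acting on the geometric representation\<close>

lemma funpow_comp_eq_foldr: "((f s \<circ> f t) ^^ k) x = foldr f (concat (replicate k [s, t])) x"
  by (induction k) auto

text \<open>The n - 1 positive and the single negative diagonal entries exhaust the diagonal, so the
  diagonalised matrix has nonzero determinant.\<close>

lemma invertible_if_lorentzian:
  fixes B :: "real ^ 's::finite ^ 's"
  assumes "lorentzian B"
  shows "invertible B"
proof -
  obtain P :: "real ^ 's ^ 's" where P: "invertible P \<and> (let D = transpose P ** B ** P in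
      (\<forall>i j. i \<noteq> j \<longrightarrow> D $ i $ j = 0) \<and>
      card {i. 0 < D $ i $ i} = CARD('s) - 1 \<and> card {i. D $ i $ i < 0} = 1)"
    using assms unfolding lorentzian_def has_signature_def ..
  define D where "D = transpose P ** B ** P"
  have diag: "i \<noteq> j \<Longrightarrow> D $ i $ j = 0"
    and card_pos: "card {i. 0 < D $ i $ i} = CARD('s) - 1"
    and card_neg: "card {i. D $ i $ i < 0} = 1" for i j
    using P by (simp_all add: D_def Let_def)
  have "card ({i. 0 < D $ i $ i} \<union> {i. D $ i $ i < 0}) = (CARD('s) - 1) + 1"
    using card_pos card_neg by (subst card_Un_disjoint) auto
  then have "card ({i. 0 < D $ i $ i} \<union> {i. D $ i $ i < 0}) = CARD('s)" by simp
  then have all: "{i. 0 < D $ i $ i} \<union> {i. D $ i $ i < 0} = UNIV"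
    by (intro card_subset_eq) simp_all
  have "D $ i $ i \<noteq> 0" for i
  proof -
    have "i \<in> {i. 0 < D $ i $ i} \<union> {i. D $ i $ i < 0}" unfolding all by simp
    then show ?thesis by auto
  qed
  then have "det D \<noteq> 0"
    using diag by (subst det_diagonal) auto
  then show ?thesis by (simp add: D_def det_mul invertible_det_nz)
qed

locale coxeter_representation =
  fixes W :: "('w, 'b) monoid_scheme"
    and g :: "'s::finite \<Rightarrow> 'w"
    and m :: "'s \<Rightarrow> 's \<Rightarrow> enat"
    and B :: "real ^ 's ^ 's"
    and \<rho> :: "'w \<Rightarrow> real ^ 's \<Rightarrow> real ^ 's"
  assumes system: "coxeter_system W g m"
    and action: "geometric_action W g B \<rho>"
begin

sublocale group_action W UNIV \<rho>
  using action by (simp add: geometric_action_def)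

sublocale group W
  using system by (simp add: coxeter_system_def)

lemma generator_closed [simp]: "g s \<in> carrier W"
  using system by (auto simp: coxeter_system_def)

lemma \<rho>_generator: "\<rho> (g s) = reflection B (simple_root s)"
  using action by (simp add: geometric_action_def)

lemma word_value_Nil [simp]: "word_value W g [] = \<one>\<^bsub>W\<^esub>"
  and word_value_Cons [simp]: "word_value W g (s # xs) = g s \<otimes>\<^bsub>W\<^esub> word_value W g xs"
  by (simp_all add: word_value_def)

lemma word_value_closed [simp]: "word_value W g xs \<in> carrier W"
  by (induction xs) auto

lemma word_value_append:
  "word_value W g (xs @ ys) = word_value W g xs \<otimes>\<^bsub>W\<^esub> word_value W g ys"
  by (induction xs) (auto simp: m_assoc)

lemma word_value_relation:
  assumes "m s t = enat k"
  shows "word_value W g (concat (replicate k [s, t])) = \<one>\<^bsub>W\<^esub>"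
  using coxeter_cong.relation[of m s t k] assms system
  by (metis coxeter_system_def word_value_Nil)

lemma inv_generator: "inv\<^bsub>W\<^esub> (g s) = g s"
proof -
  have "m s s = enat 1"
    using system by (simp add: coxeter_system_def coxeter_matrix_def one_enat_def)
  from word_value_relation[OF this] have "g s \<otimes>\<^bsub>W\<^esub> g s = \<one>\<^bsub>W\<^esub>" by simp
  then show ?thesis by (intro inv_equality) auto
qed

text \<open>Generators are their own inverses, so words without formal inverses already give the
  generated subgroup.\<close>

lemma carrier_eq_word_values: "carrier W = range (word_value W g)"
proof
  have "w \<in> range (word_value W g)" if "w \<in> generate W (range g)" for w
    using that
  proof (induction rule: generate.induct)
    case one
    show ?case by (rule range_eqI[of _ _ "[]"]) simp
  next
    case (incl h)
    then obtain s where "h = g s" by blast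
    then show ?case by (intro range_eqI[of _ _ "[s]"]) simp
  next
    case (inv h)
    then obtain s where "h = g s" by blast
    then show ?case by (intro range_eqI[of _ _ "[s]"]) (simp add: inv_generator)
  next
    case (eng h1 h2)
    then show ?case by (auto simp flip: word_value_append)
  qed
  then show "carrier W \<subseteq> range (word_value W g)"
    using system by (auto simp: coxeter_system_def)
qed auto

lemma \<rho>_word_value: "\<rho> (word_value W g xs) x = foldr (\<lambda>s. reflection B (simple_root s)) xs x"
proof (induction xs)
  case Nil
  show ?case using id_eq_one by (simp add: fun_eq_iff)
next
  case (Cons s xs)
  then show ?case by (simp add: composition_rule \<rho>_generator)
qed

lemma orbit_eq: "orbit W \<rho> x = range (\<lambda>xs. foldr (\<lambda>s. reflection B (simple_root s)) xs x)"
  unfolding orbit_def carrier_eq_word_values by (auto simp flip: \<rho>_word_value)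

text \<open>The relation is inherited from the group by applying \<rho> to both sides, rather than
  computed in the plane of the two simple roots.\<close>

lemma reflection_relation:
  assumes "m s t = enat k"
  shows "(reflection B (simple_root s) \<circ> reflection B (simple_root t)) ^^ k = id"
proof
  fix x
  have "((reflection B (simple_root s) \<circ> reflection B (simple_root t)) ^^ k) x =
      \<rho> (word_value W g (concat (replicate k [s, t]))) x"
    unfolding \<rho>_word_value
    by (rule funpow_comp_eq_foldr)
  also have "\<dots> = \<rho> (word_value W g []) x"
    by (simp add: word_value_relation[OF assms])
  finally show "((reflection B (simple_root s) \<circ> reflection B (simple_root t)) ^^ k) x = id x"
    by (simp add: \<rho>_word_value del: word_value_Nil)
qed

lemma reflection_representation_gram:
  assumes "admissible_parameters m c" "B = gram_matrix m c"
  shows "reflection_representation B"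
proof
  fix s t :: 's
  have m: "m s s = enat 1" "m s t = m t s" "s \<noteq> t \<Longrightarrow> 2 \<le> m s t"
    using system by (cases "s = t"; auto simp: coxeter_system_def coxeter_matrix_def one_enat_def)+
  show "B $ s $ s = 1" by (simp add: assms(2) gram_matrix_def m(1))
  show "B $ s $ t = B $ t $ s"
    using assms(1) m(2)
    by (auto simp: assms(2) gram_matrix_def admissible_parameters_def split: enat.split)
  assume "s \<noteq> t"
  show "B $ s $ t \<le> - 1 \<or> (\<exists>k\<ge>2. B $ s $ t = - cos (pi / real k) \<and>
      (reflection B (simple_root s) \<circ> reflection B (simple_root t)) ^^ k = id)"
  proof (cases "m s t")
    case (enat k)
    then have "2 \<le> k" using m(3)[OF \<open>s \<noteq> t\<close>] by (simp add: numeral_eq_enat)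
    moreover have "B $ s $ t = - cos (pi / real k)"
      by (simp add: assms(2) gram_matrix_def enat)
    ultimately show ?thesis using reflection_relation[OF enat] by blast
  next
    case infinity
    then show ?thesis
      using assms(1) by (simp add: assms(2) gram_matrix_def admissible_parameters_def)
  qed
qed

end

theorem theorem1p1:
  fixes W :: "('w, 'b) monoid_scheme"
    and g :: "'s::finite \<Rightarrow> 'w"
    and m :: "'s \<Rightarrow> 's \<Rightarrow> enat"
    and c :: "'s \<Rightarrow> 's \<Rightarrow> real"
    and B :: "real ^ 's ^ 's"
    and \<rho> :: "'w \<Rightarrow> real ^ 's \<Rightarrow> real ^ 's"
    and h :: "real ^ 's \<Rightarrow> real"
  assumes "coxeter_system W g m"
    and "admissible_parameters m c"
    and "B = gram_matrix m c"
    and "geometric_action W g B \<rho>"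
    and "lorentzian B"
    and "future_form B h"
  shows "limit_roots (roots W \<rho>) =
    proj_light_cone B - (\<Union>\<omega>\<in>spacelike_weights W \<rho> B. ball_interior B h \<omega>)"
proof -
  interpret coxeter_representation W g m B \<rho>
    using assms(1,4) by unfold_locales
  interpret reflection_representation B
    using assms(2,3) by (rule reflection_representation_gram)
  \<comment> \<open>Both cases of \<open>future_form\<close> take this shape; the sum of coordinates
    has all coefficients equal to 1.\<close>
  have "\<exists>a. (\<forall>s. a s > 0) \<and> h = (\<lambda>x. \<Sum>s\<in>UNIV. a s * x $ s) \<and> meets_light_cone_trivially B h"
  proof (cases "meets_light_cone_trivially B (\<lambda>x. \<Sum>s\<in>UNIV. x $ s)")
    case True
    then show ?thesis
      using assms(6) by (intro exI[of _ "\<lambda>_. 1"]) (simp add: future_form_def)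
  next
    case False
    then show ?thesis using assms(6) by (auto simp: future_form_def)
  qed
  then obtain a where a: "\<And>s. 0 < a s" and h: "h = (\<lambda>x. \<Sum>s\<in>UNIV. a s * x $ s)"
    and trivial: "meets_light_cone_trivially B h"
    by blast
  interpret lorentzian_representation B a
  proof
    show "0 < a s" for s by (rule a)
    show "invertible B" using assms(5) by (rule invertible_if_lorentzian)
    show "x = 0" if "form B x x = 0" "(\<Sum>s\<in>UNIV. a s * x $ s) = 0" for x
      using trivial that unfolding meets_light_cone_trivially_def light_cone_def h by blast
  qed
  have "height = h" by (simp add: fun_eq_iff height_def h)
  moreover have "roots W \<rho> = root_set"
    by (auto simp: roots_def root_set_def orbit_eq)
  moreover have "spacelike_weights W \<rho> B = {\<omega> \<in> weight_set. 0 < form B \<omega> \<omega>}"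
    by (auto simp: spacelike_weights_def weights_def weight_set_def orbit_eq)
  ultimately show ?thesis using limit_roots_eq_residual_set by simp
qed

end
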